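(* Let $N\ge 1$, let $K_0\subset\mathbf{R}^N$ be a bounded open set and let $K=\overline{K_0}$ be its closure. Let $\mathcal{H}$ be the Hilbert space of all $f\in L^2(\mathbf{R}^N)$ whose Fourier transform $\hat f$ is supported in $K$, and let $\Delta$ be the Laplace operator on $\mathbf{R}^N$, regarded as a bounded self-adjoint operator $\Delta:\mathcal{H}\to\mathcal{H}$. Then the spectrum of $\Delta$ over $\mathcal{H}$ is $$\sigma(\Delta)=\{-|x|^2 : x\in K\}.$$
   Context: The Fourier transform is $\hat f(x)=\frac{1}{(2\pi)^{N/2}}\int_{\mathbf{R}^N}e^{-ix\cdot y}f(y)\,dy$ for $f\in L^1(\mathbf{R}^N)$, extended to a unitary operator on $L^2(\mathbf{R}^N)$ in the usual way. The space $\mathcal{H}$ (the Paley-Wiener space of $K$) carries the inner product and norm of complex $L^2(\mathbf{R}^N)$; "$\hat f$ is supported in $K$" means $\hat f=0$ almost everywhere outside $K$. The Laplace operator acts on $\mathcal{H}$ by $\widehat{\Delta f}(x)=-|x|^2\hat f(x)$, where $|x|$ is the Euclidean norm; since $K$ is bounded, this defines a bounded operator from $\mathcal{H}$ to $\mathcal{H}$. The resolvent set $\rho(\Delta)$ is the set of $\lambda\in\mathbf{C}$ such that $\lambda-\Delta$ is invertible as a bounded operator on $\mathcal{H}$, and $\sigma(\Delta)=\mathbf{C}\setminus\rho(\Delta)$. *)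

theory Defs
  imports "HOL-Analysis.Analysis"
begin

text \<open>
  Elements of \<open>L\<^sup>2\<close> are represented by functions, two functions representing the same element iff
  they agree almost everywhere; every identity between elements of \<open>L\<^sup>2\<close> is therefore stated with
  \<open>AE\<close>. Each class of Lebesgue measurable functions has a Borel representative, so \<open>lborel\<close> gives
  the usual space.
\<close>

definition L2 :: "(real^'n \<Rightarrow> complex) set" where
  "L2 = {f. f \<in> borel_measurable lborel \<and> integrable lborel (\<lambda>x. (cmod (f x))\<^sup>2)}"

definition L2_norm :: "(real^'n \<Rightarrow> complex) \<Rightarrow> real" where
  "L2_norm f = sqrt (LINT x|lborel. (cmod (f x))\<^sup>2)"

definition L2_converges :: "(nat \<Rightarrow> real^'n \<Rightarrow> complex) \<Rightarrow> (real^'n \<Rightarrow> complex) \<Rightarrow> bool" where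
  "L2_converges F f \<longleftrightarrow>
     (\<forall>k. F k \<in> L2) \<and> f \<in> L2 \<and> (\<lambda>k. L2_norm (\<lambda>x. F k x - f x)) \<longlonglongrightarrow> 0"

definition fourier_L1 :: "(real^'n \<Rightarrow> complex) \<Rightarrow> real^'n \<Rightarrow> complex" where
  "fourier_L1 f x =
     complex_of_real (1 / (2 * pi) powr (real CARD('n) / 2)) *
     (LINT y|lborel. exp (- (\<i> * complex_of_real (x \<bullet> y))) * f y)"

text \<open>
  The extension of the Fourier transform from \<open>L\<^sup>1 \<inter> L\<^sup>2\<close> to \<open>L\<^sup>2\<close> by continuity. By Plancherel's
  theorem such a \<open>g\<close> exists for every \<open>f\<close> in \<open>L\<^sup>2\<close> and is unique up to a null set.
\<close>

definition fourier :: "(real^'n \<Rightarrow> complex) \<Rightarrow> real^'n \<Rightarrow> complex" where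
  "fourier f = (SOME g. \<exists>F. (\<forall>k. integrable lborel (F k)) \<and> L2_converges F f \<and>
                            L2_converges (\<lambda>k. fourier_L1 (F k)) g)"

definition paley_wiener :: "(real^'n) set \<Rightarrow> (real^'n \<Rightarrow> complex) set" where
  "paley_wiener K = {f \<in> L2. AE x in lborel. x \<notin> K \<longrightarrow> fourier f x = 0}"

text \<open>
  The choice is determined up to a null set whenever \<open>\<lambda>x. (norm x)\<^sup>2 * fourier f x\<close> is in \<open>L\<^sup>2\<close>, in
  particular for all \<open>f\<close> in \<open>paley_wiener K\<close> with \<open>K\<close> bounded; then \<open>laplacian f\<close> is again in
  \<open>paley_wiener K\<close>.
\<close>

definition laplacian :: "(real^'n \<Rightarrow> complex) \<Rightarrow> real^'n \<Rightarrow> complex" where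
  "laplacian f = (SOME h. h \<in> L2 \<and>
     (AE x in lborel. fourier h x = - complex_of_real ((norm x)\<^sup>2) * fourier f x))"

text \<open>
  Bounded linear operators on a linear subspace \<open>H\<close> of \<open>L\<^sup>2\<close>. Linearity and boundedness together
  imply that almost everywhere equal arguments have almost everywhere equal values, so such a map
  does act on the elements of \<open>L\<^sup>2\<close>.
\<close>

definition bounded_operator_on ::
    "(real^'n \<Rightarrow> complex) set \<Rightarrow> ((real^'n \<Rightarrow> complex) \<Rightarrow> real^'n \<Rightarrow> complex) \<Rightarrow> bool" where
  "bounded_operator_on H T \<longleftrightarrow>
     (\<forall>f\<in>H. T f \<in> H) \<and>
     (\<forall>f\<in>H. \<forall>g\<in>H. \<forall>a b. AE x in lborel. T (\<lambda>y. a * f y + b * g y) x = a * T f x + b * T g x) \<and>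
     (\<exists>C. \<forall>f\<in>H. L2_norm (T f) \<le> C * L2_norm f)"

definition resolvent_set ::
    "(real^'n \<Rightarrow> complex) set \<Rightarrow> ((real^'n \<Rightarrow> complex) \<Rightarrow> real^'n \<Rightarrow> complex) \<Rightarrow> complex set" where
  "resolvent_set H T = {z. \<exists>R. bounded_operator_on H R \<and>
     (\<forall>f\<in>H. AE x in lborel. R (\<lambda>y. z * f y - T f y) x = f x) \<and>
     (\<forall>f\<in>H. AE x in lborel. z * R f x - T (R f) x = f x)}"

definition spectrum ::
    "(real^'n \<Rightarrow> complex) set \<Rightarrow> ((real^'n \<Rightarrow> complex) \<Rightarrow> real^'n \<Rightarrow> complex) \<Rightarrow> complex set" where
  "spectrum H T = - resolvent_set H T"

end

theory Submission
  imports Defs "HOL-Probability.Characteristic_Functions"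
begin

text \<open>
  Under the Fourier transform \<open>\<F>\<close> the Laplace operator becomes multiplication by \<open>- \<bar>x\<bar>\<^sup>2\<close> on the square integrable
  functions that vanish outside \<open>K\<close>, and the spectrum of a multiplication operator is the essential range of the
  multiplier. If \<open>z\<close> is not a value \<open>- \<bar>x\<bar>\<^sup>2\<close> on the compact set \<open>K\<close>, division by \<open>z + \<bar>x\<bar>\<^sup>2\<close> is a bounded inverse
  (\<open>resolvent_set_laplacian\<close>). If \<open>z = - \<bar>x\<^sub>0\<bar>\<^sup>2\<close> with \<open>x\<^sub>0 \<in> K\<close>, every neighbourhood of \<open>x\<^sub>0\<close> meets the open set \<open>K\<^sub>0\<close> in a
  nonempty open set, and functions whose transform is the indicator of such a set are approximate eigenfunctions
  (\<open>approximate_eigenfunction\<close>), so that \<open>z - \<Delta>\<close> has no bounded inverse (\<open>not_in_resolvent_set\<close>).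

  To speak of multipliers one must know that \<open>\<F>\<close> is a linear isometry of \<open>L\<^sup>2\<close> onto itself, up to null sets
  (\<open>fourier_lincomb\<close>, \<open>fourier_norm\<close>, \<open>fourier_surj\<close>). Most of the text is a proof of this theorem of Plancherel, and it
  rests on one identity, the multiplication formula \<open>\<integral> \<F> f \<cdot> g = \<integral> f \<cdot> \<F> g\<close>, used in three ways. Applied to Gaussians it
  gives the norm identity \<open>\<parallel>\<F> f\<parallel> = \<parallel>f\<parallel>\<close> for bounded continuous integrable \<open>f\<close> (\<open>fourier_L1_isometry\<close>); such functions are
  dense, so \<open>\<F>\<close> extends by completeness. Applied to a test function it shows that the extension does not depend on the
  approximating sequence (\<open>fourier_limit_pairing\<close>, \<open>fourier_eqI\<close>). Extended to \<open>L\<^sup>2\<close> it identifies the adjoint of \<open>\<F>\<close>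
  as \<open>\<F>\<close> conjugated by complex conjugation, hence as an isometry too, and an isometry whose adjoint is isometric is
  onto.
\<close>

section \<open>Square integrable functions\<close>

lemma L2_measurable: "f \<in> L2 \<Longrightarrow> f \<in> borel_measurable borel"
  by (simp add: L2_def)

lemma L2_integrable_square: "f \<in> L2 \<Longrightarrow> integrable lborel (\<lambda>x. (cmod (f x))\<^sup>2)"
  by (simp add: L2_def)

lemma L2_norm_nonneg [simp]: "L2_norm f \<ge> 0"
  by (simp add: L2_norm_def)

lemma L2_norm_square: "(L2_norm f)\<^sup>2 = (LINT x|lborel. (cmod (f x))\<^sup>2)"
  by (simp add: L2_norm_def)

lemma L2_norm_cong_AE:
  assumes "f \<in> borel_measurable borel" "g \<in> borel_measurable borel" "AE x in lborel. f x = g x"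
  shows "L2_norm f = L2_norm g"
  unfolding L2_norm_def using assms by (intro arg_cong[where f=sqrt] integral_cong_AE) auto

lemma L2_bound:
  assumes "f \<in> L2" "g \<in> borel_measurable borel" "AE x in lborel. cmod (g x) \<le> c * cmod (f x)"
  shows "g \<in> L2" "c \<ge> 0 \<Longrightarrow> L2_norm g \<le> c * L2_norm f"
proof -
  have f [measurable]: "f \<in> borel_measurable borel" and g [measurable]: "g \<in> borel_measurable borel"
    using assms by (auto simp: L2_measurable)
  have le: "AE x in lborel. (cmod (g x))\<^sup>2 \<le> c\<^sup>2 * (cmod (f x))\<^sup>2"
    using assms(3) by eventually_elim (metis norm_ge_zero power_mono power_mult_distrib)
  have int: "integrable lborel (\<lambda>x. c\<^sup>2 * (cmod (f x))\<^sup>2)"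
    using assms(1) by (simp add: L2_integrable_square)
  have "integrable lborel (\<lambda>x. (cmod (g x))\<^sup>2)"
    by (rule Bochner_Integration.integrable_bound[OF int]) (use le in auto)
  then show *: "g \<in> L2" by (simp add: L2_def)
  have "(LINT x|lborel. (cmod (g x))\<^sup>2) \<le> (LINT x|lborel. c\<^sup>2 * (cmod (f x))\<^sup>2)"
    using int L2_integrable_square[OF *] le by (intro integral_mono_AE) auto
  also have "\<dots> = (c * L2_norm f)\<^sup>2"
    by (simp add: power_mult_distrib L2_norm_square)
  finally have "(L2_norm g)\<^sup>2 \<le> (c * L2_norm f)\<^sup>2"
    by (simp only: L2_norm_square)
  then show "L2_norm g \<le> c * L2_norm f" if "c \<ge> 0"
    by (rule power2_le_imp_le) (simp add: that)
qed

lemma L2_scale: "f \<in> L2 \<Longrightarrow> (\<lambda>x. a * f x) \<in> L2"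
  by (rule L2_bound(1)[where c="cmod a" and f=f]) (auto simp: norm_mult dest: L2_measurable)

lemma L2_norm_scale: "L2_norm (\<lambda>x. a * f x) = cmod a * L2_norm f"
  by (simp add: L2_norm_def norm_mult power_mult_distrib real_sqrt_mult)

lemma L2_cnj:
  assumes "f \<in> L2"
  shows "(\<lambda>x. cnj (f x)) \<in> L2"
proof (rule L2_bound(1)[where c=1 and f=f])
  have "cnj \<in> borel_measurable borel"
    by (intro borel_measurable_continuous_onI continuous_intros)
  from measurable_compose[OF L2_measurable[OF assms] this]
  show "(\<lambda>x. cnj (f x)) \<in> borel_measurable borel" .
qed (use assms in auto)

lemma L2_norm_cnj [simp]: "L2_norm (\<lambda>x. cnj (f x)) = L2_norm f"
  by (simp add: L2_norm_def)

lemma L2_integrable_mult: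
  assumes "f \<in> L2" "g \<in> L2"
  shows "integrable lborel (\<lambda>x. f x * g x)"
proof -
  note [measurable] = L2_measurable[OF assms(1)] L2_measurable[OF assms(2)]
  have "2 * (cmod (f x) * cmod (g x)) \<le> (cmod (f x))\<^sup>2 + (cmod (g x))\<^sup>2" for x
    using sum_squares_bound[of "cmod (f x)" "cmod (g x)"] by simp
  then have "norm (f x * g x) \<le> norm ((cmod (f x))\<^sup>2 + (cmod (g x))\<^sup>2)" for x
    by (smt (verit) mult_nonneg_nonneg norm_ge_zero norm_mult real_norm_def)
  note bound = this
  show ?thesis
  proof (rule Bochner_Integration.integrable_bound)
    show "integrable lborel (\<lambda>x. (cmod (f x))\<^sup>2 + (cmod (g x))\<^sup>2)"
      using assms by (intro Bochner_Integration.integrable_add L2_integrable_square)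
    show "AE x in lborel. norm (f x * g x) \<le> norm ((cmod (f x))\<^sup>2 + (cmod (g x))\<^sup>2)"
      by (intro AE_I2 bound)
  qed measurable
qed

lemma L2_add:
  assumes "f \<in> L2" "g \<in> L2"
  shows "(\<lambda>x. f x + g x) \<in> L2"
proof -
  note [measurable] = L2_measurable[OF assms(1)] L2_measurable[OF assms(2)]
  have "(cmod (f x + g x))\<^sup>2 \<le> 2 * (cmod (f x))\<^sup>2 + 2 * (cmod (g x))\<^sup>2" for x
  proof -
    have "(cmod (f x + g x))\<^sup>2 \<le> (cmod (f x) + cmod (g x))\<^sup>2"
      by (simp add: norm_triangle_ineq power_mono)
    then show ?thesis
      using sum_squares_bound[of "cmod (f x)" "cmod (g x)"] by (simp add: power2_sum)
  qed
  note bound = this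
  have "integrable lborel (\<lambda>x. (cmod (f x + g x))\<^sup>2)"
  proof (rule Bochner_Integration.integrable_bound)
    show "integrable lborel (\<lambda>x. 2 * (cmod (f x))\<^sup>2 + 2 * (cmod (g x))\<^sup>2)"
      using assms by (intro Bochner_Integration.integrable_add integrable_mult_right L2_integrable_square)
    show "AE x in lborel. norm ((cmod (f x + g x))\<^sup>2) \<le> norm (2 * (cmod (f x))\<^sup>2 + 2 * (cmod (g x))\<^sup>2)"
      using bound by (intro AE_I2) (smt (verit) real_norm_def zero_le_power2)
  qed measurable
  then show ?thesis by (simp add: L2_def)
qed

lemma L2_diff:
  assumes "f \<in> L2" "g \<in> L2"
  shows "(\<lambda>x. f x - g x) \<in> L2"
  using L2_add[OF assms(1) L2_scale[OF assms(2), of "-1"]] by simp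

lemma L2_Cauchy_Schwarz_norm:
  assumes "f \<in> L2" "g \<in> L2"
  shows "(LINT x|lborel. cmod (f x) * cmod (g x)) \<le> L2_norm f * L2_norm g"
proof -
  note [measurable] = L2_measurable[OF assms(1)] L2_measurable[OF assms(2)]
  let ?I = "LINT x|lborel. cmod (f x) * cmod (g x)"
  have int: "integrable lborel (\<lambda>x. cmod (f x) * cmod (g x))"
    using integrable_norm[OF L2_integrable_mult[OF assms]] by (simp add: norm_mult)
  have nonneg: "0 \<le> ?I" by simp
  have "ennreal (?I\<^sup>2) = (\<integral>\<^sup>+x. ennreal (cmod (f x)) * ennreal (cmod (g x)) \<partial>lborel)\<^sup>2"
    by (subst ennreal_power[symmetric, OF nonneg], subst nn_integral_eq_integral[symmetric, OF int])
      (auto simp: ennreal_mult)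
  also have "\<dots> \<le> (\<integral>\<^sup>+x. (ennreal (cmod (f x)))\<^sup>2 \<partial>lborel) * (\<integral>\<^sup>+x. (ennreal (cmod (g x)))\<^sup>2 \<partial>lborel)"
    by (rule Cauchy_Schwarz_nn_integral) auto
  also have "\<dots> = ennreal ((L2_norm f)\<^sup>2) * ennreal ((L2_norm g)\<^sup>2)"
    using assms unfolding L2_norm_square
    by (subst (1 2) nn_integral_eq_integral[symmetric])
      (auto simp: L2_integrable_square ennreal_power)
  also have "\<dots> = ennreal ((L2_norm f * L2_norm g)\<^sup>2)"
    by (simp add: ennreal_mult power_mult_distrib)
  finally have "?I\<^sup>2 \<le> (L2_norm f * L2_norm g)\<^sup>2"
    by (simp add: ennreal_le_iff)
  then show ?thesis
    by (rule power2_le_imp_le) simp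
qed

lemma L2_Cauchy_Schwarz:
  assumes "f \<in> L2" "g \<in> L2"
  shows "cmod (LINT x|lborel. f x * g x) \<le> L2_norm f * L2_norm g"
proof -
  have "cmod (LINT x|lborel. f x * g x) \<le> (LINT x|lborel. cmod (f x) * cmod (g x))"
    using integral_norm_bound[of lborel "\<lambda>x. f x * g x"] by (simp add: norm_mult)
  with L2_Cauchy_Schwarz_norm[OF assms] show ?thesis by simp
qed

lemma L2_norm_triangle:
  assumes "f \<in> L2" "g \<in> L2"
  shows "L2_norm (\<lambda>x. f x + g x) \<le> L2_norm f + L2_norm g"
proof -
  note int = L2_integrable_square[OF assms(1)] L2_integrable_square[OF assms(2)]
    L2_integrable_square[OF L2_add[OF assms]]
  have int': "integrable lborel (\<lambda>x. cmod (f x) * cmod (g x))"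
    using integrable_norm[OF L2_integrable_mult[OF assms]] by (simp add: norm_mult)
  have "(cmod (f x + g x))\<^sup>2 \<le> (cmod (f x))\<^sup>2 + 2 * (cmod (f x) * cmod (g x)) + (cmod (g x))\<^sup>2" for x
  proof -
    have "(cmod (f x + g x))\<^sup>2 \<le> (cmod (f x) + cmod (g x))\<^sup>2"
      by (simp add: norm_triangle_ineq power_mono)
    then show ?thesis by (simp add: power2_sum)
  qed
  then have "(L2_norm (\<lambda>x. f x + g x))\<^sup>2 \<le>
      (LINT x|lborel. (cmod (f x))\<^sup>2 + 2 * (cmod (f x) * cmod (g x)) + (cmod (g x))\<^sup>2)"
    unfolding L2_norm_square using int int' by (intro integral_mono) auto
  also have "\<dots> = (L2_norm f)\<^sup>2 + 2 * (LINT x|lborel. cmod (f x) * cmod (g x)) + (L2_norm g)\<^sup>2"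
    using int int' by (simp add: L2_norm_square)
  also have "\<dots> \<le> (L2_norm f + L2_norm g)\<^sup>2"
    using L2_Cauchy_Schwarz_norm[OF assms] by (simp add: power2_sum)
  finally show ?thesis
    by (rule power2_le_imp_le) simp
qed

lemma L2_norm_diff_commute: "L2_norm (\<lambda>x. f x - g x) = L2_norm (\<lambda>x. g x - f x)"
  by (simp add: L2_norm_def norm_minus_commute)

lemma L2_norm_diff_triangle:
  assumes "f \<in> L2" "g \<in> L2" "h \<in> L2"
  shows "L2_norm (\<lambda>x. f x - h x) \<le> L2_norm (\<lambda>x. f x - g x) + L2_norm (\<lambda>x. g x - h x)"
  using L2_norm_triangle[OF L2_diff[OF assms(1,2)] L2_diff[OF assms(2,3)]] by simp

lemma L2_norm_diff_le:
  assumes "f \<in> L2" "g \<in> L2"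
  shows "\<bar>L2_norm f - L2_norm g\<bar> \<le> L2_norm (\<lambda>x. f x - g x)"
  using L2_norm_triangle[OF L2_diff[OF assms] assms(2)] L2_norm_triangle[OF L2_diff[OF assms(2,1)] assms(1)]
    L2_norm_diff_commute[of f g] by simp

lemma L2_norm_eq_0_iff:
  assumes "f \<in> L2"
  shows "L2_norm f = 0 \<longleftrightarrow> (AE x in lborel. f x = 0)"
  using integral_nonneg_eq_0_iff_AE[OF L2_integrable_square[OF assms]]
  by (simp add: L2_norm_def)

lemma L2_convergesD:
  assumes "L2_converges F f"
  shows "F k \<in> L2" "f \<in> L2" "(\<lambda>k. L2_norm (\<lambda>x. F k x - f x)) \<longlonglongrightarrow> 0"
  using assms by (auto simp: L2_converges_def)

lemma L2_converges_norm:
  assumes "L2_converges F f"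
  shows "(\<lambda>k. L2_norm (F k)) \<longlonglongrightarrow> L2_norm f"
proof (rule LIM_zero_cancel, rule Lim_null_comparison)
  show "\<forall>\<^sub>F k in sequentially. norm (L2_norm (F k) - L2_norm f) \<le> L2_norm (\<lambda>x. F k x - f x)"
    using L2_norm_diff_le[OF L2_convergesD(1)[OF assms] L2_convergesD(2)[OF assms]] by simp
qed (use L2_convergesD[OF assms] in auto)

lemma L2_converges_pairing:
  assumes "L2_converges F f" "L2_converges G g"
  shows "(\<lambda>k. LINT x|lborel. F k x * G k x) \<longlonglongrightarrow> (LINT x|lborel. f x * g x)"
proof (rule LIM_zero_cancel, rule Lim_null_comparison)
  note F = L2_convergesD[OF assms(1)] and G = L2_convergesD[OF assms(2)]
  show "\<forall>\<^sub>F k in sequentially. norm ((LINT x|lborel. F k x * G k x) - (LINT x|lborel. f x * g x))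
     \<le> L2_norm (\<lambda>x. F k x - f x) * L2_norm (G k) + L2_norm f * L2_norm (\<lambda>x. G k x - g x)"
  proof (intro always_eventually allI)
    fix k
    have "(LINT x|lborel. F k x * G k x) - (LINT x|lborel. f x * g x)
        = (LINT x|lborel. (F k x - f x) * G k x) + (LINT x|lborel. f x * (G k x - g x))"
      using L2_integrable_mult[OF F(1) G(1), of k k] L2_integrable_mult[OF F(2) G(1), of k]
        L2_integrable_mult[OF F(2) G(2)]
      by (simp add: left_diff_distrib right_diff_distrib)
    also have "norm \<dots> \<le> L2_norm (\<lambda>x. F k x - f x) * L2_norm (G k) + L2_norm f * L2_norm (\<lambda>x. G k x - g x)"
      using F G by (intro norm_triangle_mono L2_Cauchy_Schwarz L2_diff)
    finally show "norm ((LINT x|lborel. F k x * G k x) - (LINT x|lborel. f x * g x))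
     \<le> L2_norm (\<lambda>x. F k x - f x) * L2_norm (G k) + L2_norm f * L2_norm (\<lambda>x. G k x - g x)" .
  qed
  have "(\<lambda>k. L2_norm (\<lambda>x. F k x - f x) * L2_norm (G k) + L2_norm f * L2_norm (\<lambda>x. G k x - g x))
     \<longlonglongrightarrow> 0 * L2_norm g + L2_norm f * 0"
    by (intro tendsto_intros F G L2_converges_norm assms)
  then show "(\<lambda>k. L2_norm (\<lambda>x. F k x - f x) * L2_norm (G k) + L2_norm f * L2_norm (\<lambda>x. G k x - g x)) \<longlonglongrightarrow> 0"
    by simp
qed

lemma L2_converges_const: "f \<in> L2 \<Longrightarrow> L2_converges (\<lambda>_. f) f"
  by (simp add: L2_converges_def L2_norm_def)

text \<open>
  Dominated convergence for \<open>\<bar>F\<^sub>k - f\<bar>\<^sup>2\<close>, which is at most \<open>(2w)\<^sup>2\<close>.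
\<close>

lemma L2_converges_dominated:
  assumes F: "\<And>k. F k \<in> borel_measurable borel" and f: "f \<in> borel_measurable borel"
    and w: "integrable lborel (\<lambda>x. (w x)\<^sup>2)" "\<And>x. w x \<ge> 0"
    and bound: "\<And>k. AE x in lborel. cmod (F k x) \<le> w x"
    and lim: "AE x in lborel. (\<lambda>k. F k x) \<longlonglongrightarrow> f x"
  shows "L2_converges F f"
proof -
  note [measurable] = F f
  have FL: "F k \<in> L2" for k
  proof -
    have "integrable lborel (\<lambda>x. (cmod (F k x))\<^sup>2)"
      by (rule Bochner_Integration.integrable_bound[OF w(1)])
        (use bound[of k] in \<open>auto elim!: eventually_mono intro: power_mono\<close>)
    then show ?thesis by (simp add: L2_def F)
  qed
  have fw: "AE x in lborel. cmod (f x) \<le> w x"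
  proof -
    have "AE x in lborel. \<forall>k. cmod (F k x) \<le> w x"
      using bound by (simp add: AE_all_countable)
    with lim show ?thesis
    proof eventually_elim
      case (elim x)
      then show ?case
        by (intro LIMSEQ_le_const2[OF tendsto_norm[OF elim(1)]]) auto
    qed
  qed
  have fL: "f \<in> L2"
  proof -
    have "integrable lborel (\<lambda>x. (cmod (f x))\<^sup>2)"
      by (rule Bochner_Integration.integrable_bound[OF w(1)])
        (use fw in \<open>auto elim!: eventually_mono intro: power_mono\<close>)
    then show ?thesis by (simp add: L2_def f)
  qed
  have "(\<lambda>k. LINT x|lborel. (cmod (F k x - f x))\<^sup>2) \<longlonglongrightarrow> (LINT x|(lborel :: (real^'a) measure). 0)"
  proof (rule integral_dominated_convergence[where w="\<lambda>x. (2 * w x)\<^sup>2"])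
    show "integrable lborel (\<lambda>x. (2 * w x)\<^sup>2)" using w(1) by (simp add: power_mult_distrib)
    show "AE x in lborel. (\<lambda>k. (cmod (F k x - f x))\<^sup>2) \<longlonglongrightarrow> 0"
      using lim by eventually_elim (auto intro!: tendsto_eq_intros dest: LIM_zero simp: tendsto_norm_zero_iff)
    show "AE x in lborel. norm ((cmod (F k x - f x))\<^sup>2) \<le> (2 * w x)\<^sup>2" for k
      using fw bound[of k]
    proof eventually_elim
      case (elim x)
      then have "cmod (F k x - f x) \<le> 2 * w x"
        using norm_triangle_ineq4[of "F k x" "f x"] by linarith
      from power_mono[OF this norm_ge_zero, of 2] show ?case by simp
    qed
  qed auto
  then have "(\<lambda>k. L2_norm (\<lambda>x. F k x - f x)) \<longlonglongrightarrow> 0"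
    unfolding L2_norm_def by (auto intro!: tendsto_eq_intros)
  with FL fL show ?thesis by (simp add: L2_converges_def)
qed

text \<open>
  Completeness, for sequences whose successive differences \<open>d\<^sub>k\<close> have norms at most \<open>(1/2)\<^sup>k\<close>, a speed at which
  an element of a space with a dense class can always be approximated from that class. The weighted series
  \<open>S = \<Sum>k. 2\<^sup>k \<bar>d\<^sub>k\<bar>\<^sup>2\<close> has a finite integral, and Cauchy-Schwarz gives \<open>\<Sum>k. \<bar>d\<^sub>k\<bar> \<le> sqrt (2 S)\<close>. Where \<open>S\<close> is
  finite, that is almost everywhere, the sequence converges, and it is dominated by
  \<open>\<bar>F\<^sub>0\<bar> + sqrt (2 S)\<close>, which is square integrable.
\<close>

lemma L2_complete:
  fixes F :: "nat \<Rightarrow> real^'n \<Rightarrow> complex"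
  assumes F: "\<And>k. F k \<in> L2"
    and fast: "\<And>k. L2_norm (\<lambda>x. F (Suc k) x - F k x) \<le> (1 / 2) ^ k"
  shows "\<exists>f. L2_converges F f"
proof -
  note [measurable] = L2_measurable[OF F]
  define d where "d k x = cmod (F (Suc k) x - F k x)" for k x
  define g where "g k x = 2 ^ k * (d k x)\<^sup>2" for k x
  define S where "S x = (\<Sum>k. g k x)" for x
  have dm [measurable]: "d k \<in> borel_measurable borel" for k
    unfolding d_def by measurable
  have gm [measurable]: "g k \<in> borel_measurable borel" for k
    unfolding g_def by measurable
  have g0: "g k x \<ge> 0" for k x
    by (simp add: g_def)
  have gint: "integrable lborel (g k)" for k
    using L2_integrable_square[OF L2_diff[OF F[of "Suc k"] F[of k]]] by (simp add: g_def[abs_def] d_def)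
  have glint: "(LINT x|lborel. g k x) \<le> (1 / 2) ^ k" for k
  proof -
    have "(LINT x|lborel. g k x) = 2 ^ k * (L2_norm (\<lambda>x. F (Suc k) x - F k x))\<^sup>2"
      by (simp add: g_def d_def L2_norm_square)
    also have "\<dots> \<le> 2 ^ k * ((1 / 2) ^ k)\<^sup>2"
      by (intro mult_left_mono power_mono fast) auto
    also have "\<dots> = (1 / 2) ^ k"
      by (simp add: power2_eq_square power_one_over)
    finally show ?thesis .
  qed
  have gsum: "summable (\<lambda>k. LINT x|lborel. g k x)"
    by (rule summable_comparison_test'[where g="\<lambda>k. (1 / 2) ^ k" and N=0])
      (use glint g0 in \<open>auto simp: integral_nonneg_AE intro!: summable_geometric\<close>)
  have "(\<integral>\<^sup>+x. (\<Sum>k. ennreal (g k x)) \<partial>lborel) = (\<Sum>k. \<integral>\<^sup>+x. ennreal (g k x) \<partial>lborel)"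
    by (rule nn_integral_suminf) measurable
  also have "\<dots> = (\<Sum>k. ennreal (LINT x|lborel. g k x))"
    using g0 by (intro suminf_cong nn_integral_eq_integral gint) auto
  also have "\<dots> = ennreal (\<Sum>k. LINT x|lborel. g k x)"
    by (rule suminf_ennreal2[OF _ gsum]) (intro integral_nonneg_AE AE_I2 g0)
  also have "\<dots> < \<infinity>"
    by simp
  finally have "AE x in lborel. (\<Sum>k. ennreal (g k x)) \<noteq> \<infinity>"
    by (intro nn_integral_PInf_AE) auto
  then have gsumx: "AE x in lborel. summable (\<lambda>k. g k x)"
    by eventually_elim (rule summable_suminf_not_top, auto simp: g0)
  have Sint: "integrable lborel S"
    unfolding S_def using gint gsumx gsum g0 by (intro integrable_suminf) auto
  have CS: "(\<Sum>j<k. d j x) \<le> sqrt (2 * S x)" if "summable (\<lambda>k. g k x)" for k x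
  proof -
    \<comment> \<open>the weights \<open>(1/2)\<^sup>j\<close> are chosen to sum to at most 2\<close>
    have dj: "d j x = sqrt ((1 / 2) ^ j) * sqrt (g j x)" for j
    proof -
      have "(1 / 2) ^ j * g j x = (d j x)\<^sup>2"
        by (simp add: g_def power_one_over)
      then show ?thesis
        unfolding real_sqrt_mult[symmetric] by (simp add: d_def)
    qed
    have "(\<Sum>j<k. d j x)\<^sup>2 \<le> (\<Sum>j<k. (sqrt ((1 / 2) ^ j))\<^sup>2) * (\<Sum>j<k. (sqrt (g j x))\<^sup>2)"
      unfolding dj by (rule Cauchy_Schwarz_ineq_sum)
    also have "\<dots> = (\<Sum>j<k. (1 / 2) ^ j) * (\<Sum>j<k. g j x)"
      by (simp add: g0)
    also have "\<dots> \<le> 2 * S x"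
    proof (rule mult_mono)
      show "(\<Sum>j<k. (1 / 2) ^ j) \<le> (2 :: real)"
        by (simp add: sum_gp_strict)
      show "(\<Sum>j<k. g j x) \<le> S x"
        unfolding S_def by (rule sum_le_suminf[OF that]) (auto simp: g0)
    qed (auto simp: g0 sum_nonneg)
    finally show ?thesis by (rule real_le_rsqrt)
  qed
  define w where "w x = cmod (F 0 x) + sqrt (2 * \<bar>S x\<bar>)" for x
  have wint: "integrable lborel (\<lambda>x. (w x)\<^sup>2)"
  proof (rule Bochner_Integration.integrable_bound)
    show "integrable lborel (\<lambda>x. 2 * (cmod (F 0 x))\<^sup>2 + 4 * \<bar>S x\<bar>)"
      using L2_integrable_square[OF F] Sint by simp
    have [measurable]: "S \<in> borel_measurable borel"
      using borel_measurable_integrable[OF Sint] by simp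
    show "(\<lambda>x. (w x)\<^sup>2) \<in> borel_measurable lborel"
      unfolding w_def by measurable
    show "AE x in lborel. norm ((w x)\<^sup>2) \<le> norm (2 * (cmod (F 0 x))\<^sup>2 + 4 * \<bar>S x\<bar>)"
    proof (rule AE_I2)
      fix x
      have "(w x)\<^sup>2 \<le> 2 * (cmod (F 0 x))\<^sup>2 + 2 * (sqrt (2 * \<bar>S x\<bar>))\<^sup>2"
        using sum_squares_bound[of "cmod (F 0 x)" "sqrt (2 * \<bar>S x\<bar>)"] unfolding w_def power2_sum by linarith
      then show "norm ((w x)\<^sup>2) \<le> norm (2 * (cmod (F 0 x))\<^sup>2 + 4 * \<bar>S x\<bar>)"
        by simp
    qed
  qed
  have tele: "F k x = F 0 x + (\<Sum>j<k. F (Suc j) x - F j x)" for k x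
    by (simp add: sum_lessThan_telescope[of "\<lambda>j. F j x"])
  have bound: "AE x in lborel. cmod (F k x) \<le> w x" for k
    using gsumx
  proof eventually_elim
    case (elim x)
    have "cmod (F k x) \<le> cmod (F 0 x) + (\<Sum>j<k. d j x)"
      unfolding d_def by (subst tele[of k x]) (intro norm_triangle_mono order_refl norm_sum)
    also have "\<dots> \<le> w x"
      using CS[OF elim, of k] suminf_nonneg[OF elim g0] unfolding w_def S_def by simp
    finally show ?case .
  qed
  have conv: "AE x in lborel. convergent (\<lambda>k. F k x)"
    using gsumx
  proof eventually_elim
    case (elim x)
    have "summable (\<lambda>j. d j x)"
      by (rule bounded_imp_summable[where B="sqrt (2 * S x)"])
        (use CS[OF elim, of "Suc _"] in \<open>auto simp: d_def lessThan_Suc_atMost\<close>)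
    then have "summable (\<lambda>j. F (Suc j) x - F j x)"
      unfolding d_def by (rule summable_norm_cancel)
    then have "convergent (\<lambda>k. F 0 x + (\<Sum>j<k. F (Suc j) x - F j x))"
      by (intro convergent_add convergent_const) (simp add: summable_iff_convergent)
    then show ?case by (simp flip: tele)
  qed
  have "L2_converges F (\<lambda>x. lim (\<lambda>k. F k x))"
  proof (rule L2_converges_dominated[OF _ _ wint _ bound])
    show "AE x in lborel. (\<lambda>k. F k x) \<longlonglongrightarrow> lim (\<lambda>k. F k x)"
      using conv by eventually_elim (simp add: convergent_LIMSEQ_iff)
    show "(\<lambda>x. lim (\<lambda>k. F k x)) \<in> borel_measurable borel"
      by (rule borel_measurable_lim_metric) measurable
  qed (auto simp: w_def)
  then show ?thesis by blast
qed

section \<open>Gaussian integrals\<close>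

text \<open>
  Lebesgue measure is the product of its one-dimensional copies along the basis vectors, so integrals of
  products of functions of single coordinates factor.
\<close>

lemma lborel_prod_Basis:
  fixes f :: "'a::euclidean_space \<Rightarrow> real \<Rightarrow> complex"
  assumes f: "\<And>b. b \<in> Basis \<Longrightarrow> integrable lborel (f b)"
  shows "integrable lborel (\<lambda>x::'a. \<Prod>b\<in>Basis. f b (x \<bullet> b))"
    and "(LINT x|lborel. (\<Prod>b\<in>Basis. f b (x \<bullet> b))) = (\<Prod>b\<in>Basis. LINT t|lborel. f b t)"
proof -
  interpret product_sigma_finite "\<lambda>_::'a. lborel :: real measure"
    by standard
  have [measurable]: "f b \<in> borel_measurable borel" if "b \<in> Basis" for b
    using borel_measurable_integrable[OF f[OF that]] by simp
  have m: "(\<lambda>y. \<Sum>b\<in>Basis. y b *\<^sub>R b) \<in> (\<Pi>\<^sub>M b\<in>Basis. lborel) \<rightarrow>\<^sub>M (borel :: 'a measure)"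
    by measurable
  have p: "(\<lambda>x::'a. \<Prod>b\<in>Basis. f b (x \<bullet> b)) \<in> borel_measurable borel"
    by measurable
  show "integrable lborel (\<lambda>x::'a. \<Prod>b\<in>Basis. f b (x \<bullet> b))"
    using product_integrable_prod[of Basis f] f
    by (subst lborel_eq) (simp add: integrable_distr_eq[OF m p])
  show "(LINT x|lborel. (\<Prod>b\<in>Basis. f b (x \<bullet> b))) = (\<Prod>b\<in>Basis. LINT t|lborel. f b t)"
    using product_integral_prod[of Basis f] f
    by (subst lborel_eq) (simp add: integral_distr[OF m p])
qed

text \<open>
  The characteristic function of the standard normal distribution, with the normalizing factor of
  the density removed.
\<close>

lemma gaussian_real:
  fixes a :: real
  shows "integrable lborel (\<lambda>t. iexp (a * t) * complex_of_real (exp (- t\<^sup>2 / 2)))"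
    and "(LINT t|lborel. iexp (a * t) * complex_of_real (exp (- t\<^sup>2 / 2))) = complex_of_real (sqrt (2 * pi) * exp (- a\<^sup>2 / 2))"
proof -
  have eq: "std_normal_density t *\<^sub>R iexp (a * t) =
      complex_of_real (1 / sqrt (2 * pi)) * (iexp (a * t) * complex_of_real (exp (- t\<^sup>2 / 2)))" for t
    by (simp add: std_normal_density_def scaleR_conv_of_real)
  have one: "complex_of_real (sqrt (2 * pi)) * complex_of_real (1 / sqrt (2 * pi)) = 1"
    by (subst of_real_mult[symmetric]) simp
  have "integrable std_normal_distribution (\<lambda>t. iexp (a * t))"
  proof -
    interpret real_distribution std_normal_distribution by (rule real_dist_normal_dist)
    show ?thesis by (rule integrable_iexp) auto
  qed
  then have "integrable lborel (\<lambda>t. std_normal_density t *\<^sub>R iexp (a * t))"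
    by (subst (asm) integrable_density) (auto simp: normal_density_nonneg)
  then have "integrable lborel (\<lambda>t. complex_of_real (sqrt (2 * pi)) * (std_normal_density t *\<^sub>R iexp (a * t)))"
    by (rule integrable_mult_right)
  moreover have "complex_of_real (sqrt (2 * pi)) * (std_normal_density t *\<^sub>R iexp (a * t)) =
      iexp (a * t) * complex_of_real (exp (- t\<^sup>2 / 2))" for t
    unfolding eq mult.assoc[symmetric] one by (simp only: mult_1_left)
  ultimately show "integrable lborel (\<lambda>t. iexp (a * t) * complex_of_real (exp (- t\<^sup>2 / 2)))"
    by (simp only:)
  have "complex_of_real (exp (- a\<^sup>2 / 2)) = (LINT t|std_normal_distribution. iexp (a * t))"
    using fun_cong[OF char_std_normal_distribution, of a] by (simp add: char_def)
  also have "\<dots> = (LINT t|lborel. std_normal_density t *\<^sub>R iexp (a * t))"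
    by (subst integral_density) (auto simp: normal_density_nonneg)
  also have "\<dots> = complex_of_real (1 / sqrt (2 * pi)) * (LINT t|lborel. iexp (a * t) * complex_of_real (exp (- t\<^sup>2 / 2)))"
    unfolding eq by (rule integral_mult_right_zero)
  finally have E: "complex_of_real (exp (- a\<^sup>2 / 2)) = complex_of_real (1 / sqrt (2 * pi)) *
    (LINT t|lborel. iexp (a * t) * complex_of_real (exp (- t\<^sup>2 / 2)))" .
  show "(LINT t|lborel. iexp (a * t) * complex_of_real (exp (- t\<^sup>2 / 2))) = complex_of_real (sqrt (2 * pi) * exp (- a\<^sup>2 / 2))"
    unfolding of_real_mult E mult.assoc[symmetric] one by (simp only: mult_1_left)
qed

text \<open>
  Both the Gaussian and the plane wave \<open>iexp (a \<bullet> x)\<close> are products over the coordinates, which reduces the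
  integral to the one-dimensional one.
\<close>

lemma gaussian_euclidean:
  fixes a :: "real^'n"
  shows "integrable lborel (\<lambda>x. iexp (a \<bullet> x) * complex_of_real (exp (- (norm x)\<^sup>2 / 2)))"
    and "(LINT x|lborel. iexp (a \<bullet> x) * complex_of_real (exp (- (norm x)\<^sup>2 / 2))) =
      complex_of_real ((2 * pi) powr (real CARD('n) / 2) * exp (- (norm a)\<^sup>2 / 2))"
proof -
  let ?g = "\<lambda>b t. iexp ((a \<bullet> b) * t) * complex_of_real (exp (- t\<^sup>2 / 2))"
  have norm: "(norm x)\<^sup>2 = (\<Sum>b\<in>Basis. (x \<bullet> b)\<^sup>2)" for x :: "real^'n"
    unfolding power2_norm_eq_inner by (subst euclidean_inner) (simp only: power2_eq_square)
  have ex: "exp (- (norm x)\<^sup>2 / 2) = (\<Prod>b\<in>Basis. exp (- (x \<bullet> b)\<^sup>2 / 2))" for x :: "real^'n"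
    by (simp add: norm sum_divide_distrib sum_negf exp_sum[symmetric])
  have ix: "iexp (a \<bullet> x) = (\<Prod>b\<in>Basis. iexp ((a \<bullet> b) * (x \<bullet> b)))" for x
    by (simp add: euclidean_inner[of a x] sum_distrib_left exp_sum[symmetric])
  have eq: "iexp (a \<bullet> x) * complex_of_real (exp (- (norm x)\<^sup>2 / 2)) = (\<Prod>b\<in>Basis. ?g b (x \<bullet> b))" for x
    unfolding ix ex by (simp add: prod.distrib)
  show "integrable lborel (\<lambda>x. iexp (a \<bullet> x) * complex_of_real (exp (- (norm x)\<^sup>2 / 2)))"
    unfolding eq by (rule lborel_prod_Basis(1)) (rule gaussian_real)
  have "(LINT x|lborel. iexp (a \<bullet> x) * complex_of_real (exp (- (norm x)\<^sup>2 / 2)))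
      = (\<Prod>b\<in>Basis. LINT t|lborel. ?g b t)"
    unfolding eq by (rule lborel_prod_Basis(2)) (rule gaussian_real)
  also have "\<dots> = (\<Prod>b\<in>(Basis :: (real^'n) set). complex_of_real (sqrt (2 * pi) * exp (- (a \<bullet> b)\<^sup>2 / 2)))"
    by (simp only: gaussian_real)
  also have "\<dots> = complex_of_real (sqrt (2 * pi) ^ CARD('n) * exp (- (norm a)\<^sup>2 / 2))"
    unfolding ex by (simp add: prod.distrib)
  also have "sqrt (2 * pi) ^ CARD('n) = ((2 * pi) powr (1 / 2)) powr real CARD('n)"
    by (subst powr_realpow) (simp_all add: powr_half_sqrt)
  also have "\<dots> = (2 * pi) powr (real CARD('n) / 2)"
    by (simp add: powr_powr)
  finally show "(LINT x|lborel. iexp (a \<bullet> x) * complex_of_real (exp (- (norm x)\<^sup>2 / 2))) =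
      complex_of_real ((2 * pi) powr (real CARD('n) / 2) * exp (- (norm a)\<^sup>2 / 2))" .
qed

lemma gaussian_integrable:
  "integrable lborel (\<lambda>x::real^'n. exp (- (norm x)\<^sup>2 / 2))"
  using integrable_norm[OF gaussian_euclidean(1)[of "0 :: real^'n"]] by simp

lemma lborel_integral_affine:
  fixes f :: "'a::euclidean_space \<Rightarrow> complex"
  assumes "f \<in> borel_measurable borel" "c \<noteq> 0"
  shows "(LINT x|lborel. f x) = complex_of_real (\<bar>c\<bar> ^ DIM('a)) * (LINT x|lborel. f (t + c *\<^sub>R x))"
  using assms
  by (subst lborel_affine[OF assms(2), of t]) (simp add: integral_density integral_distr scaleR_conv_of_real)

lemma lborel_integrable_affine:
  fixes f :: "'a::euclidean_space \<Rightarrow> 'b::{banach, second_countable_topology}"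
  assumes "integrable lborel f" "c \<noteq> 0"
  shows "integrable lborel (\<lambda>x. f (t + c *\<^sub>R x))"
proof -
  have [measurable]: "f \<in> borel_measurable borel"
    using borel_measurable_integrable[OF assms(1)] by simp
  have "integrable lborel (\<lambda>x. \<bar>c\<bar> ^ DIM('a) *\<^sub>R f (t + c *\<^sub>R x))"
    using assms(1)
    by (subst (asm) lborel_affine[OF assms(2), of t]) (simp add: integrable_density integrable_distr_eq)
  from integrable_scaleR_right[OF this, of "1 / \<bar>c\<bar> ^ DIM('a)"] assms(2) show ?thesis
    by simp
qed

section \<open>A dense class of test functions\<close>

text \<open>
  Boundedness and continuity serve to pass to the limit in Gaussian averages, and integrability makes the Fourier
  integral absolutely convergent.
\<close>

definition test_functions :: "(real^'n \<Rightarrow> complex) set" where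
  "test_functions = {f. continuous_on UNIV f \<and> bounded (range f) \<and> integrable lborel f}"

lemma test_functions_L2: "test_functions \<subseteq> L2"
proof
  fix f :: "real^'n \<Rightarrow> complex"
  assume f: "f \<in> test_functions"
  then obtain B where B: "\<And>x. cmod (f x) \<le> B"
    by (auto simp: test_functions_def bounded_iff)
  have int: "integrable lborel f" and [measurable]: "f \<in> borel_measurable borel"
    using f by (auto simp: test_functions_def intro: borel_measurable_continuous_onI)
  have "integrable lborel (\<lambda>x. (cmod (f x))\<^sup>2)"
  proof (rule Bochner_Integration.integrable_bound)
    show "integrable lborel (\<lambda>x. B * cmod (f x))" using int by simp
    have "cmod (f x) \<le> \<bar>B\<bar>" for x using B[of x] by linarith
    then have "(cmod (f x))\<^sup>2 \<le> \<bar>B\<bar> * cmod (f x)" for x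
      using mult_right_mono[of "cmod (f x)" "\<bar>B\<bar>" "cmod (f x)"] by (simp add: power2_eq_square)
    then show "AE x in lborel. norm ((cmod (f x))\<^sup>2) \<le> norm (B * cmod (f x))"
      by (intro AE_I2) (simp add: abs_mult)
  qed measurable
  then show "f \<in> L2" by (simp add: L2_def)
qed

lemma test_functions_lincomb:
  assumes "f \<in> test_functions" "g \<in> test_functions"
  shows "(\<lambda>x. a * f x + b * g x) \<in> test_functions"
proof -
  obtain B where B: "\<And>x. cmod (f x) \<le> B"
    using assms by (auto simp: test_functions_def bounded_iff)
  obtain C where C: "\<And>x. cmod (g x) \<le> C"
    using assms by (auto simp: test_functions_def bounded_iff)
  have "cmod (a * f x + b * g x) \<le> cmod a * B + cmod b * C" for x
    by (intro norm_triangle_mono) (auto simp: norm_mult intro!: mult_left_mono B C)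
  then have "bounded (range (\<lambda>x. a * f x + b * g x))"
    by (auto simp: bounded_iff)
  then show ?thesis
    using assms by (auto simp: test_functions_def intro!: continuous_intros)
qed

text \<open>
  A Gaussian weight \<open>w\<close> takes care of decay and of size at once. Cutting \<open>f\<close> off where \<open>\<bar>f\<bar> > (k + 1) w\<close> changes it
  little for large \<open>k\<close>, because \<open>w\<close> is positive everywhere. The quotient of the truncation by \<open>w\<close> is bounded by
  \<open>M = k + 1\<close> and is an almost everywhere limit of continuous functions; projected onto the disc of radius \<open>M\<close> and
  multiplied by \<open>w\<close>, these become test functions dominated by \<open>M w\<close>.
\<close>

lemma test_functions_dense:
  fixes f :: "real^'n \<Rightarrow> complex"
  assumes f: "f \<in> L2" and e: "e > 0"
  shows "\<exists>\<phi>\<in>test_functions. L2_norm (\<lambda>x. \<phi> x - f x) < e"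
proof -
  note [measurable] = L2_measurable[OF f]
  define w where "w x = exp (- (norm x)\<^sup>2 / 2)" for x :: "real^'n"
  have wpos: "w x > 0" for x by (simp add: w_def)
  have wle: "w x \<le> 1" for x by (simp add: w_def)
  have wcont: "continuous_on UNIV w" unfolding w_def by (intro continuous_intros) auto
  have [measurable]: "w \<in> borel_measurable borel"
    using wcont by (rule borel_measurable_continuous_onI)
  have wint: "integrable lborel w" unfolding w_def by (rule gaussian_integrable)
  have w2int: "integrable lborel (\<lambda>x. (c * w x)\<^sup>2)" for c
  proof (rule Bochner_Integration.integrable_bound)
    show "integrable lborel (\<lambda>x. c\<^sup>2 * w x)" using wint by simp
    have "(w x)\<^sup>2 \<le> w x" for x
      using wpos[of x] wle[of x] by (simp add: power2_eq_square mult_le_cancel_left1)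
    then show "AE x in lborel. norm ((c * w x)\<^sup>2) \<le> norm (c\<^sup>2 * w x)"
      using wpos by (intro AE_I2) (simp add: power_mult_distrib mult_left_mono abs_mult less_imp_le)
  qed measurable
  define T where "T k x = (if cmod (f x) \<le> real (Suc k) * w x then f x else 0)" for k :: nat and x
  have Tm [measurable]: "T k \<in> borel_measurable borel" for k
    unfolding T_def by measurable
  have "L2_converges T f"
  proof (rule L2_converges_dominated)
    show "integrable lborel (\<lambda>x. (cmod (f x))\<^sup>2)" using f by (rule L2_integrable_square)
    show "AE x in lborel. (\<lambda>k. T k x) \<longlonglongrightarrow> f x"
    proof (rule AE_I2)
      fix x
      obtain K :: nat where K: "cmod (f x) / w x \<le> real K"
        using real_arch_simple by blast
      have "T k x = f x" if "k \<ge> K" for k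
      proof -
        have "cmod (f x) / w x \<le> real (Suc k)" using K that by linarith
        then show ?thesis using wpos[of x] by (simp add: T_def divide_le_eq)
      qed
      then show "(\<lambda>k. T k x) \<longlonglongrightarrow> f x"
        by (intro tendsto_eventually) (auto simp: eventually_sequentially)
    qed
  qed (auto simp: T_def)
  then have "(\<lambda>k. L2_norm (\<lambda>x. T k x - f x)) \<longlonglongrightarrow> 0" by (rule L2_convergesD)
  from order_tendstoD(2)[OF this, of "e / 2"] e
  obtain k where k: "L2_norm (\<lambda>x. T k x - f x) < e / 2"
    by (auto simp: eventually_sequentially)
  define M where "M = real (Suc k)"
  have M: "M > 0" by (simp add: M_def)
  define h where "h x = T k x / complex_of_real (w x)" for x
  have [measurable]: "h \<in> borel_measurable borel" unfolding h_def by measurable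
  have hM: "cmod (h x) \<le> M" for x
    using wpos[of x] M by (auto simp: h_def T_def M_def norm_divide divide_le_eq)
  have "h \<in> borel_measurable (lebesgue_on UNIV)"
    unfolding lebesgue_on_UNIV_eq by (rule measurable_completion) simp
  then have "h measurable_on UNIV"
    by (simp add: measurable_on_iff_borel_measurable)
  then obtain N g where N: "negligible N" and gc: "\<And>n::nat. continuous_on UNIV (g n)"
    and g: "\<And>x. x \<notin> N \<Longrightarrow> (\<lambda>n. g n x) \<longlonglongrightarrow> h x"
    by (auto simp: measurable_on_def)
  \<comment> \<open>radial projection onto the disc of radius \<open>M\<close>\<close>
  define clip where "clip z = z * complex_of_real (M / max M (cmod z))" for z
  have clipM: "cmod (clip z) \<le> M" for z
    using M by (auto simp: clip_def norm_mult norm_divide field_simps max_def)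
  have clip_id: "clip z = z" if "cmod z \<le> M" for z
    using M that by (simp add: clip_def max_def)
  have clip_cont: "continuous_on UNIV clip"
    unfolding clip_def using M by (intro continuous_intros) (auto simp: max_def)
  define \<phi> where "\<phi> n x = complex_of_real (w x) * clip (g n x)" for n x
  have \<phi>cont: "continuous_on UNIV (\<phi> n)" for n
    unfolding \<phi>_def
    by (intro continuous_intros wcont continuous_on_compose2[OF clip_cont gc]) auto
  have \<phi>m [measurable]: "\<phi> n \<in> borel_measurable borel" for n
    using \<phi>cont by (rule borel_measurable_continuous_onI)
  have \<phi>le: "cmod (\<phi> n x) \<le> M * w x" for n x
    using clipM[of "g n x"] wpos[of x] by (simp add: \<phi>_def norm_mult mult.commute)
  have \<phi>test: "\<phi> n \<in> test_functions" for n
  proof -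
    have "M * w x \<le> M" for x using wle[of x] M by simp
    then have "bounded (range (\<phi> n))"
      using \<phi>le order_trans unfolding bounded_iff by blast
    moreover have "integrable lborel (\<phi> n)"
      by (rule Bochner_Integration.integrable_bound[where f="\<lambda>x. M * w x"])
        (use wint \<phi>le[of n] M wpos in \<open>auto simp: less_imp_le abs_mult\<close>)
    ultimately show ?thesis using \<phi>cont by (simp add: test_functions_def)
  qed
  have "L2_converges \<phi> (T k)"
  proof (rule L2_converges_dominated[OF _ _ w2int[of M]])
    have "AE x in lebesgue. x \<notin> N"
      using N by (intro AE_not_in) (simp add: negligible_iff_null_sets)
    then have "AE x in lborel. x \<notin> N"
      by (simp add: AE_completion_iff)
    then show "AE x in lborel. (\<lambda>n. \<phi> n x) \<longlonglongrightarrow> T k x"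
    proof eventually_elim
      case (elim x)
      have "(\<lambda>n. \<phi> n x) \<longlonglongrightarrow> complex_of_real (w x) * clip (h x)"
        unfolding \<phi>_def
        by (intro tendsto_intros continuous_on_tendsto_compose[OF clip_cont g[OF elim]]) auto
      also have "complex_of_real (w x) * clip (h x) = T k x"
        unfolding clip_id[OF hM] using wpos[of x] by (simp add: h_def)
      finally show ?case .
    qed
  qed (use \<phi>le M wpos in \<open>auto simp: less_imp_le\<close>)
  note \<phi>T = L2_convergesD[OF this]
  from order_tendstoD(2)[OF \<phi>T(3), of "e / 2"] e
  obtain n where n: "L2_norm (\<lambda>x. \<phi> n x - T k x) < e / 2"
    by (auto simp: eventually_sequentially)
  have "L2_norm (\<lambda>x. \<phi> n x - f x) < e"
    using L2_norm_diff_triangle[OF \<phi>T(1,2) f, of n] n k by linarith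
  with \<phi>test show ?thesis by blast
qed

section \<open>The Fourier integral\<close>

lemma fourier_L1_measurable:
  assumes [measurable]: "f \<in> borel_measurable borel"
  shows "fourier_L1 f \<in> borel_measurable borel"
  unfolding fourier_L1_def[abs_def] by measurable

lemma fourier_L1_bounded:
  fixes f :: "real^'n \<Rightarrow> complex"
  shows "cmod (fourier_L1 f x) \<le> (1 / (2 * pi) powr (real CARD('n) / 2)) * (LINT y|lborel. cmod (f y))"
proof -
  have "cmod (LINT y|lborel. exp (- (\<i> * complex_of_real (x \<bullet> y))) * f y)
      \<le> (LINT y|lborel. cmod (exp (- (\<i> * complex_of_real (x \<bullet> y))) * f y))"
    by (rule integral_norm_bound)
  also have "\<dots> = (LINT y|lborel. cmod (f y))"
    by (simp add: norm_mult)
  finally show ?thesis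
    unfolding fourier_L1_def norm_mult norm_of_real by (simp add: divide_right_mono)
qed

lemma fourier_kernel_integrable:
  assumes "integrable lborel f"
  shows "integrable lborel (\<lambda>y. exp (- (\<i> * complex_of_real (x \<bullet> y))) * f y)"
proof (rule Bochner_Integration.integrable_bound[OF assms])
  have [measurable]: "f \<in> borel_measurable borel"
    using borel_measurable_integrable[OF assms] by simp
  show "(\<lambda>y. exp (- (\<i> * complex_of_real (x \<bullet> y))) * f y) \<in> borel_measurable lborel"
    by measurable
qed (simp add: norm_mult)

lemma fourier_L1_lincomb:
  assumes "integrable lborel f" "integrable lborel g"
  shows "fourier_L1 (\<lambda>y. a * f y + b * g y) x = a * fourier_L1 f x + b * fourier_L1 g x"
proof -
  note int = fourier_kernel_integrable[OF assms(1), of x] fourier_kernel_integrable[OF assms(2), of x]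
  have "(LINT y|lborel. exp (- (\<i> * complex_of_real (x \<bullet> y))) * (a * f y + b * g y)) =
     (LINT y|lborel. a * (exp (- (\<i> * complex_of_real (x \<bullet> y))) * f y) + b * (exp (- (\<i> * complex_of_real (x \<bullet> y))) * g y))"
    by (simp add: algebra_simps)
  also have "\<dots> = a * (LINT y|lborel. exp (- (\<i> * complex_of_real (x \<bullet> y))) * f y)
      + b * (LINT y|lborel. exp (- (\<i> * complex_of_real (x \<bullet> y))) * g y)"
    using int by simp
  finally show ?thesis
    by (simp add: fourier_L1_def distrib_left mult.left_commute)
qed

text \<open>
  Fubini, as the kernel \<open>exp (- \<i> (x \<bullet> y))\<close> is symmetric and of modulus one.
\<close>

lemma fourier_L1_multiplication:
  fixes f g :: "real^'n \<Rightarrow> complex"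
  assumes f: "integrable lborel f" and g: "integrable lborel g"
  shows "(LINT x|lborel. fourier_L1 f x * g x) = (LINT y|lborel. f y * fourier_L1 g y)"
proof -
  let ?c = "complex_of_real (1 / (2 * pi) powr (real CARD('n) / 2))"
  let ?k = "\<lambda>x y. exp (- (\<i> * complex_of_real (x \<bullet> y))) * f y * g x"
  have [measurable]: "f \<in> borel_measurable borel" "g \<in> borel_measurable borel"
    using borel_measurable_integrable[OF f] borel_measurable_integrable[OF g] by simp_all
  have int: "integrable (lborel \<Otimes>\<^sub>M lborel) (case_prod ?k)"
  proof (rule lborel_pair.Fubini_integrable)
    show "case_prod ?k \<in> borel_measurable (lborel \<Otimes>\<^sub>M lborel)"
      by measurable
    have "(LINT y|lborel. norm (case_prod ?k (x, y))) = (LINT y|lborel. cmod (f y)) * cmod (g x)" for x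
      by (simp add: norm_mult)
    then show "integrable lborel (\<lambda>x. LINT y|lborel. norm (case_prod ?k (x, y)))"
      using g by simp
    show "AE x in lborel. integrable lborel (\<lambda>y. case_prod ?k (x, y))"
      using fourier_kernel_integrable[OF f] by (intro AE_I2) simp
  qed
  have "(LINT y|lborel. ?k x y) = (LINT y|lborel. exp (- (\<i> * complex_of_real (x \<bullet> y))) * f y) * g x" for x
    by (rule integral_mult_left_zero)
  then have "(LINT x|lborel. fourier_L1 f x * g x) = ?c * (LINT x|lborel. LINT y|lborel. ?k x y)"
    by (simp only: fourier_L1_def mult.assoc integral_mult_right_zero)
  also have "(LINT x|lborel. LINT y|lborel. ?k x y) = (LINT y|lborel. LINT x|lborel. ?k x y)"
    using lborel_pair.Fubini_integral[OF int] by simp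
  also have "\<dots> = (LINT y|lborel. f y * (LINT x|lborel. exp (- (\<i> * complex_of_real (y \<bullet> x))) * g x))"
    by (simp add: inner_commute mult.assoc mult.left_commute[of _ "f _"])
  finally show ?thesis
    by (simp add: fourier_L1_def mult.left_commute[of _ "?c"])
qed

definition gaussian_wave :: "real^'n \<Rightarrow> real \<Rightarrow> real^'n \<Rightarrow> complex" where
  "gaussian_wave a e x = iexp (a \<bullet> x) * complex_of_real (exp (- (norm (e *\<^sub>R x))\<^sup>2 / 2))"

lemma gaussian_scaled_integrable:
  "e \<noteq> 0 \<Longrightarrow> integrable lborel (\<lambda>x::real^'n. exp (- (norm (e *\<^sub>R x))\<^sup>2 / 2))"
  using lborel_integrable_affine[OF gaussian_integrable, of e 0] by simp

lemma gaussian_wave_measurable [measurable]: "gaussian_wave a e \<in> borel_measurable borel"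
  unfolding gaussian_wave_def[abs_def] by measurable

lemma gaussian_wave_integrable:
  "e \<noteq> 0 \<Longrightarrow> integrable lborel (gaussian_wave a e)"
  by (rule Bochner_Integration.integrable_bound[OF gaussian_scaled_integrable])
    (auto simp: gaussian_wave_def norm_mult)

text \<open>
  Modulation by \<open>iexp (a \<bullet> x)\<close> translates the transform by \<open>a\<close>, and dilation by \<open>e\<close> turns a wide Gaussian into a
  narrow one, of total mass \<open>(2 pi) powr (N / 2)\<close> independently of \<open>e\<close>.
\<close>

lemma fourier_L1_gaussian_wave:
  fixes a v :: "real^'n"
  assumes e: "e > 0"
  shows "fourier_L1 (gaussian_wave a e) (a + e *\<^sub>R v) = complex_of_real (exp (- (norm v)\<^sup>2 / 2) / e ^ CARD('n))"
proof -
  let ?h = "\<lambda>u. iexp ((- v) \<bullet> u) * complex_of_real (exp (- (norm u)\<^sup>2 / 2))"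
  let ?p = "(2 * pi) powr (real CARD('n) / 2)"
  have "exp (- (\<i> * complex_of_real ((a + e *\<^sub>R v) \<bullet> x))) * gaussian_wave a e x = ?h (0 + e *\<^sub>R x)" for x
    by (simp add: gaussian_wave_def mult_exp_exp inner_add_left algebra_simps flip: mult.assoc)
  then have "fourier_L1 (gaussian_wave a e) (a + e *\<^sub>R v) = complex_of_real (1 / ?p) * (LINT x|lborel. ?h (0 + e *\<^sub>R x))"
    by (simp only: fourier_L1_def)
  also have "(LINT x|lborel. ?h (0 + e *\<^sub>R x)) = complex_of_real (1 / e ^ CARD('n)) * (LINT x|lborel. ?h x)"
    by (subst lborel_integral_affine[where c=e and t=0 and f="?h"]) (use e in auto)
  also have "(LINT x|lborel. ?h x) = complex_of_real (?p * exp (- (norm v)\<^sup>2 / 2))"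
    using gaussian_euclidean(2)[of "- v"] by simp
  also have "complex_of_real (1 / ?p) * (complex_of_real (1 / e ^ CARD('n)) * complex_of_real (?p * exp (- (norm v)\<^sup>2 / 2)))
      = complex_of_real (exp (- (norm v)\<^sup>2 / 2) / e ^ CARD('n))"
    unfolding of_real_mult[symmetric] of_real_eq_iff by simp
  finally show ?thesis .
qed

text \<open>
  Fourier inversion, regularized: the inverse transform of \<open>fourier_L1 f\<close> damped by a Gaussian is, up to a constant,
  an average of \<open>f\<close> over a neighbourhood of size \<open>e\<close> of the point \<open>a\<close>.
\<close>

lemma fourier_L1_gaussian_wave_pairing:
  fixes f :: "real^'n \<Rightarrow> complex"
  assumes f: "integrable lborel f" and e: "e > 0"
  shows "(LINT x|lborel. fourier_L1 f x * gaussian_wave a e x) =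
         (LINT v|lborel. f (a + e *\<^sub>R v) * complex_of_real (exp (- (norm v)\<^sup>2 / 2)))"
proof -
  have [measurable]: "f \<in> borel_measurable borel"
    using borel_measurable_integrable[OF f] by simp
  have [measurable]: "fourier_L1 (gaussian_wave a e) \<in> borel_measurable borel"
    by (rule fourier_L1_measurable) measurable
  have "(LINT x|lborel. fourier_L1 f x * gaussian_wave a e x) = (LINT y|lborel. f y * fourier_L1 (gaussian_wave a e) y)"
    using e by (intro fourier_L1_multiplication f gaussian_wave_integrable) auto
  also have "\<dots> = complex_of_real (e ^ CARD('n)) *
      (LINT v|lborel. f (a + e *\<^sub>R v) * fourier_L1 (gaussian_wave a e) (a + e *\<^sub>R v))"
    using e by (subst lborel_integral_affine[where c=e and t=a]) auto
  also have "\<dots> = (LINT v|lborel. complex_of_real (e ^ CARD('n)) *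
       (f (a + e *\<^sub>R v) * fourier_L1 (gaussian_wave a e) (a + e *\<^sub>R v)))"
    by simp
  also have "\<dots> = (LINT v|lborel. f (a + e *\<^sub>R v) * complex_of_real (exp (- (norm v)\<^sup>2 / 2)))"
    using e by (intro Bochner_Integration.integral_cong) (auto simp: fourier_L1_gaussian_wave)
  finally show ?thesis .
qed

text \<open>
  The left-hand side is the pairing of \<open>fourier_L1 f\<close> with \<open>h = cnj (fourier_L1 f)\<close> times a Gaussian. The
  multiplication formula moves the transform over to \<open>h\<close>, and the transform of \<open>h\<close> at \<open>y\<close> is, up to the
  normalizing factor, the conjugate of the regularized inversion integral at \<open>y\<close>.
\<close>

lemma fourier_L1_square_regularized:
  fixes f :: "real^'n \<Rightarrow> complex"
  assumes f: "integrable lborel f" and e: "e > 0"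
  shows "integrable lborel (\<lambda>x. (cmod (fourier_L1 f x))\<^sup>2 * exp (- (norm (e *\<^sub>R x))\<^sup>2 / 2))"
    and "complex_of_real (LINT x|lborel. (cmod (fourier_L1 f x))\<^sup>2 * exp (- (norm (e *\<^sub>R x))\<^sup>2 / 2)) =
      complex_of_real (1 / (2 * pi) powr (real CARD('n) / 2)) *
      (LINT y|lborel. f y * cnj (LINT v|lborel. f (y + e *\<^sub>R v) * complex_of_real (exp (- (norm v)\<^sup>2 / 2))))"
proof -
  let ?c = "1 / (2 * pi) powr (real CARD('n) / 2)"
  let ?W = "\<lambda>x::real^'n. exp (- (norm (e *\<^sub>R x))\<^sup>2 / 2)"
  let ?F = "fourier_L1 f"
  define B where "B = ?c * (LINT y|lborel. cmod (f y))"
  have [measurable]: "f \<in> borel_measurable borel"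
    using borel_measurable_integrable[OF f] by simp
  have [measurable]: "?F \<in> borel_measurable borel"
    by (rule fourier_L1_measurable) measurable
  have FB: "cmod (?F x) \<le> B" for x
    unfolding B_def by (rule fourier_L1_bounded)
  have B0: "B \<ge> 0" using FB[of 0] norm_ge_zero order_trans by blast
  have W: "integrable lborel ?W"
    using e by (intro gaussian_scaled_integrable) auto
  define h where "h x = cnj (?F x) * complex_of_real (?W x)" for x
  have cnjm: "cnj \<in> borel_measurable borel"
    by (intro borel_measurable_continuous_onI continuous_intros)
  have [measurable]: "(\<lambda>x. cnj (?F x)) \<in> borel_measurable borel"
    using measurable_compose[OF _ cnjm] by measurable
  have hint: "integrable lborel h"
  proof (rule Bochner_Integration.integrable_bound)
    show "integrable lborel (\<lambda>x. B * ?W x)" using W by simp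
    show "h \<in> borel_measurable lborel" unfolding h_def[abs_def] by measurable
    show "AE x in lborel. norm (h x) \<le> norm (B * ?W x)"
      using FB B0 by (intro AE_I2) (simp add: h_def norm_mult abs_mult mult_right_mono)
  qed
  show "integrable lborel (\<lambda>x. (cmod (?F x))\<^sup>2 * ?W x)"
  proof (rule Bochner_Integration.integrable_bound)
    show "integrable lborel (\<lambda>x. B\<^sup>2 * ?W x)" using W by simp
    show "(\<lambda>x. (cmod (?F x))\<^sup>2 * ?W x) \<in> borel_measurable lborel" by measurable
    show "AE x in lborel. norm ((cmod (?F x))\<^sup>2 * ?W x) \<le> norm (B\<^sup>2 * ?W x)"
      using FB B0 by (intro AE_I2) (simp add: abs_mult mult_right_mono power_mono)
  qed
  have hhat: "fourier_L1 h y = complex_of_real ?c * cnj (LINT v|lborel. f (y + e *\<^sub>R v) * complex_of_real (exp (- (norm v)\<^sup>2 / 2)))" for y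
  proof -
    have "exp (- (\<i> * complex_of_real (y \<bullet> x))) * h x = cnj (?F x * gaussian_wave y e x)" for x
      by (simp add: h_def gaussian_wave_def exp_cnj)
    then have "fourier_L1 h y = complex_of_real ?c * (LINT x|lborel. cnj (?F x * gaussian_wave y e x))"
      by (simp only: fourier_L1_def)
    also have "(LINT x|lborel. cnj (?F x * gaussian_wave y e x)) = cnj (LINT x|lborel. ?F x * gaussian_wave y e x)"
      by (simp del: complex_cnj_mult)
    finally show ?thesis
      by (simp only: fourier_L1_gaussian_wave_pairing[OF f e])
  qed
  have "complex_of_real (LINT x|lborel. (cmod (?F x))\<^sup>2 * ?W x) = (LINT x|lborel. complex_of_real ((cmod (?F x))\<^sup>2 * ?W x))"
    by (rule integral_complex_of_real[symmetric])
  also have "\<dots> = (LINT x|lborel. ?F x * h x)"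
    unfolding h_def of_real_mult complex_norm_square mult.assoc ..
  also have "\<dots> = (LINT y|lborel. f y * fourier_L1 h y)"
    by (rule fourier_L1_multiplication[OF f hint])
  also have "\<dots> = complex_of_real ?c * (LINT y|lborel. f y * cnj (LINT v|lborel. f (y + e *\<^sub>R v) * complex_of_real (exp (- (norm v)\<^sup>2 / 2))))"
    by (simp only: hhat mult.left_commute[of "f _"] integral_mult_right_zero)
  finally show "complex_of_real (LINT x|lborel. (cmod (?F x))\<^sup>2 * ?W x) = complex_of_real ?c *
      (LINT y|lborel. f y * cnj (LINT v|lborel. f (y + e *\<^sub>R v) * complex_of_real (exp (- (norm v)\<^sup>2 / 2))))" .
qed

text \<open>
  The Gaussian averages of a bounded continuous \<open>f\<close> converge pointwise to \<open>f\<close> times the mass of the Gaussian, and they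
  are uniformly bounded, so that a multiple of \<open>\<bar>f\<bar>\<close> dominates the outer integrand.
\<close>

lemma gaussian_average_tendsto:
  fixes f :: "real^'n \<Rightarrow> complex"
  assumes f: "f \<in> test_functions" and e: "e \<longlonglongrightarrow> 0"
  shows "(\<lambda>k. LINT y|lborel. f y * cnj (LINT v|lborel. f (y + e k *\<^sub>R v) * complex_of_real (exp (- (norm v)\<^sup>2 / 2))))
    \<longlonglongrightarrow> complex_of_real ((2 * pi) powr (real CARD('n) / 2) * (LINT y|lborel. (cmod (f y))\<^sup>2))"
proof -
  let ?p = "(2 * pi) powr (real CARD('n) / 2)"
  let ?W = "\<lambda>x::real^'n. exp (- (norm x)\<^sup>2 / 2)"
  obtain B where B: "\<And>x. cmod (f x) \<le> B"
    using f by (auto simp: test_functions_def bounded_iff)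
  have B0: "B \<ge> 0" using B[of 0] norm_ge_zero order_trans by blast
  have int: "integrable lborel f" and cont: "continuous_on UNIV f"
    using f by (auto simp: test_functions_def)
  have [measurable]: "f \<in> borel_measurable borel"
    using cont by (rule borel_measurable_continuous_onI)
  define P where "P k y = (LINT v|lborel. f (y + e k *\<^sub>R v) * complex_of_real (?W v))" for k y
  have Pm [measurable]: "P k \<in> borel_measurable borel" for k
    unfolding P_def by measurable
  have Plim: "(\<lambda>k. P k y) \<longlonglongrightarrow> f y * complex_of_real ?p" for y
  proof -
    have "(\<lambda>k. P k y) \<longlonglongrightarrow> (LINT v|lborel. f y * complex_of_real (?W v))"
      unfolding P_def
    proof (rule integral_dominated_convergence[where w="\<lambda>v. B * ?W v"])
      show "integrable lborel (\<lambda>v. B * ?W v)" by (intro integrable_mult_right gaussian_integrable)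
      show "AE v in lborel. (\<lambda>k. f (y + e k *\<^sub>R v) * complex_of_real (?W v)) \<longlonglongrightarrow> f y * complex_of_real (?W v)"
      proof (intro AE_I2 tendsto_mult tendsto_const)
        fix v
        have "(\<lambda>k. y + e k *\<^sub>R v) \<longlonglongrightarrow> y"
          using e by (auto intro!: tendsto_eq_intros)
        then show "(\<lambda>k. f (y + e k *\<^sub>R v)) \<longlonglongrightarrow> f y"
          by (rule continuous_on_tendsto_compose[OF cont]) auto
      qed
      show "AE v in lborel. norm (f (y + e k *\<^sub>R v) * complex_of_real (?W v)) \<le> B * ?W v" for k
        using B by (intro AE_I2) (simp add: norm_mult mult_right_mono)
    qed measurable
    also have "(LINT v|lborel. f y * complex_of_real (?W v)) = f y * complex_of_real ?p"
      using gaussian_euclidean(2)[of "0 :: real^'n"] by simp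
    finally show ?thesis .
  qed
  have Pb: "cmod (P k y) \<le> B * ?p" for k y
  proof -
    have intW: "integrable lborel (\<lambda>v. f (y + e k *\<^sub>R v) * complex_of_real (?W v))"
      by (rule Bochner_Integration.integrable_bound[where f="\<lambda>v. B * ?W v"])
        (use gaussian_integrable B B0 in \<open>auto simp: norm_mult abs_mult mult_right_mono\<close>)
    have "cmod (P k y) \<le> (LINT v|lborel. B * ?W v)"
      unfolding P_def
    proof (rule order_trans[OF integral_norm_bound integral_mono])
      show "integrable lborel (\<lambda>v. cmod (f (y + e k *\<^sub>R v) * complex_of_real (?W v)))"
        using intW by (rule integrable_norm)
      show "integrable lborel (\<lambda>v. B * ?W v)" by (intro integrable_mult_right gaussian_integrable)
      show "cmod (f (y + e k *\<^sub>R v) * complex_of_real (?W v)) \<le> B * ?W v" for v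
        using B by (simp add: norm_mult mult_right_mono)
    qed
    also have "(LINT v|lborel. B * ?W v) = B * ?p"
    proof -
      have "complex_of_real (LINT v|lborel. ?W v) = complex_of_real ?p"
        using gaussian_euclidean(2)[of "0 :: real^'n"] by simp
      then show ?thesis by (simp only: of_real_eq_iff integral_mult_right_zero)
    qed
    finally show ?thesis .
  qed
  have cnjm: "cnj \<in> borel_measurable borel"
    by (intro borel_measurable_continuous_onI continuous_intros)
  have [measurable]: "(\<lambda>x. cnj (P k x)) \<in> borel_measurable borel" for k
    using measurable_compose[OF Pm cnjm] .
  have [measurable]: "(\<lambda>x. cnj (f x)) \<in> borel_measurable borel"
    using measurable_compose[OF _ cnjm] by measurable
  have "(\<lambda>k. LINT y|lborel. f y * cnj (P k y)) \<longlonglongrightarrow> (LINT y|lborel. f y * cnj (f y * complex_of_real ?p))"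
  proof (rule integral_dominated_convergence[where w="\<lambda>y. (B * ?p) * cmod (f y)"])
    show "integrable lborel (\<lambda>y. (B * ?p) * cmod (f y))" using int by simp
    show "AE y in lborel. (\<lambda>k. f y * cnj (P k y)) \<longlonglongrightarrow> f y * cnj (f y * complex_of_real ?p)"
      by (intro AE_I2 tendsto_intros Plim)
    show "AE y in lborel. norm (f y * cnj (P k y)) \<le> (B * ?p) * cmod (f y)" for k
      using Pb by (intro AE_I2) (simp add: norm_mult mult.commute[of "cmod (f _)"] mult_right_mono)
    show "(\<lambda>y. f y * cnj (f y * complex_of_real ?p)) \<in> borel_measurable lborel"
      unfolding complex_cnj_mult by measurable
  qed measurable
  also have "(LINT y|lborel. f y * cnj (f y * complex_of_real ?p)) =
      (LINT y|lborel. complex_of_real ?p * complex_of_real ((cmod (f y))\<^sup>2))"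
    by (simp only: complex_norm_square complex_cnj_mult complex_cnj_complex_of_real mult_ac)
  also have "\<dots> = complex_of_real (?p * (LINT y|lborel. (cmod (f y))\<^sup>2))"
    by (simp only: integral_mult_right_zero integral_complex_of_real of_real_mult)
  finally show ?thesis
    unfolding P_def .
qed

text \<open>
  Plancherel for test functions. As \<open>e\<close> decreases to \<open>0\<close>, the integrals of \<open>\<bar>fourier_L1 f\<bar>\<^sup>2\<close> against
  \<open>exp (- \<bar>e x\<bar>\<^sup>2 / 2)\<close> increase to the full integral, and they are known to converge to the square of the norm of \<open>f\<close>.
  That the full integral is finite is part of the conclusion, which is why monotone convergence is used.
\<close>

lemma fourier_L1_isometry:
  fixes f :: "real^'n \<Rightarrow> complex"
  assumes f: "f \<in> test_functions"
  shows "fourier_L1 f \<in> L2" "L2_norm (fourier_L1 f) = L2_norm f"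
proof -
  let ?p = "(2 * pi) powr (real CARD('n) / 2)"
  let ?F = "fourier_L1 f"
  define e where "e k = inverse (real (Suc k))" for k
  have epos: "e k > 0" for k by (simp add: e_def)
  have elim: "e \<longlonglongrightarrow> 0" unfolding e_def by (rule LIMSEQ_inverse_real_of_nat)
  have edec: "e l \<le> e k" if "k \<le> l" for k l
    using that by (simp add: e_def)
  have int: "integrable lborel f" 
    using f by (auto simp: test_functions_def)
  have [measurable]: "f \<in> borel_measurable borel"
    using borel_measurable_integrable[OF int] by simp
  have Fm [measurable]: "?F \<in> borel_measurable borel"
    by (rule fourier_L1_measurable) measurable
  \<comment> \<open>the widths \<open>e k\<close> decrease, so the damped squares increase with \<open>k\<close>\<close>
  define s where "s k x = (cmod (?F x))\<^sup>2 * exp (- (norm (e k *\<^sub>R x))\<^sup>2 / 2)" for k x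
  have "(\<lambda>k. complex_of_real (1 / ?p) *
      (LINT y|lborel. f y * cnj (LINT v|lborel. f (y + e k *\<^sub>R v) * complex_of_real (exp (- (norm v)\<^sup>2 / 2)))))
      \<longlonglongrightarrow> complex_of_real (1 / ?p) * complex_of_real (?p * (LINT y|lborel. (cmod (f y))\<^sup>2))"
    by (intro tendsto_mult tendsto_const gaussian_average_tendsto f elim)
  also have "complex_of_real (1 / ?p) * complex_of_real (?p * (LINT y|lborel. (cmod (f y))\<^sup>2)) =
      complex_of_real (LINT y|lborel. (cmod (f y))\<^sup>2)"
    unfolding of_real_mult[symmetric] by simp
  finally have "(\<lambda>k. complex_of_real (LINT x|lborel. s k x)) \<longlonglongrightarrow> complex_of_real (LINT y|lborel. (cmod (f y))\<^sup>2)"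
    unfolding s_def fourier_L1_square_regularized(2)[OF int epos] .
  then have slim: "(\<lambda>k. LINT x|lborel. s k x) \<longlonglongrightarrow> (LINT y|lborel. (cmod (f y))\<^sup>2)"
    by (simp only: tendsto_of_real_iff)
  have sint: "integrable lborel (s k)" for k
    unfolding s_def by (rule fourier_L1_square_regularized(1)[OF int epos])
  have smono: "s k x \<le> s l x" if "k \<le> l" for k l x
  proof -
    have "norm (e l *\<^sub>R x) \<le> norm (e k *\<^sub>R x)"
      using edec[OF that] epos[of k] epos[of l] by (simp add: mult_right_mono)
    then have "(norm (e l *\<^sub>R x))\<^sup>2 \<le> (norm (e k *\<^sub>R x))\<^sup>2"
      by (rule power_mono) simp
    then show ?thesis
      unfolding s_def by (intro mult_left_mono) auto
  qed
  have sx: "(\<lambda>k. s k x) \<longlonglongrightarrow> (cmod (?F x))\<^sup>2" for x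
  proof -
    have "(\<lambda>k. s k x) \<longlonglongrightarrow> (cmod (?F x))\<^sup>2 * exp (- (norm (0 *\<^sub>R x))\<^sup>2 / 2)"
      unfolding s_def by (intro tendsto_intros elim) auto
    then show ?thesis by simp
  qed
  have mono: "AE x in lborel. mono (\<lambda>k. s k x)"
    by (intro AE_I2 monoI smono)
  have lim: "AE x in lborel. (\<lambda>k. s k x) \<longlonglongrightarrow> (cmod (?F x))\<^sup>2"
    by (intro AE_I2 sx)
  have meas: "(\<lambda>x. (cmod (?F x))\<^sup>2) \<in> borel_measurable lborel"
    by measurable
  show "?F \<in> L2"
    using integrable_monotone_convergence[OF sint mono lim slim meas] by (simp add: L2_def)
  show "L2_norm ?F = L2_norm f"
    using integral_monotone_convergence[OF sint mono lim slim meas] by (simp add: L2_norm_def)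
qed

section \<open>The Fourier transform on square integrable functions\<close>

text \<open>
  The speed of convergence is what \<open>L2_complete\<close> asks for.
\<close>

lemma test_functions_approximation:
  assumes f: "f \<in> L2"
  obtains \<Phi> where "\<And>k. \<Phi> k \<in> test_functions" "L2_converges \<Phi> f"
    "\<And>k. L2_norm (\<lambda>x. \<Phi> (Suc k) x - \<Phi> k x) \<le> (1 / 2) ^ k"
proof -
  have "\<forall>k. \<exists>\<phi>\<in>test_functions. L2_norm (\<lambda>x. \<phi> x - f x) < (1 / 2) ^ Suc k"
    by (intro allI test_functions_dense[OF f]) simp
  then obtain \<Phi> where \<Phi>: "\<And>k. \<Phi> k \<in> test_functions" "\<And>k. L2_norm (\<lambda>x. \<Phi> k x - f x) < (1 / 2) ^ Suc k"
    by metis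
  have \<Phi>L: "\<Phi> k \<in> L2" for k
    using \<Phi>(1) test_functions_L2 by blast
  have "L2_norm (\<lambda>x. \<Phi> (Suc k) x - \<Phi> k x) \<le> (1 / 2) ^ k" for k
  proof -
    have "L2_norm (\<lambda>x. \<Phi> (Suc k) x - \<Phi> k x) \<le> (1 / 2) ^ Suc (Suc k) + (1 / 2) ^ Suc k"
      using L2_norm_diff_triangle[OF \<Phi>L[of "Suc k"] f \<Phi>L[of k]] L2_norm_diff_commute[of f "\<Phi> k"]
        \<Phi>(2)[of k] \<Phi>(2)[of "Suc k"] by linarith
    also have "\<dots> \<le> (1 / 2) ^ k" by simp
    finally show ?thesis .
  qed
  moreover have "L2_converges \<Phi> f"
  proof -
    have "(\<lambda>k. L2_norm (\<lambda>x. \<Phi> k x - f x)) \<longlonglongrightarrow> 0"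
    proof (rule Lim_null_comparison)
      show "\<forall>\<^sub>F k in sequentially. norm (L2_norm (\<lambda>x. \<Phi> k x - f x)) \<le> (1 / 2) ^ Suc k"
        using \<Phi>(2) by (intro always_eventually allI) (simp add: less_imp_le)
      show "(\<lambda>k. (1 / 2) ^ Suc k :: real) \<longlonglongrightarrow> 0"
        by (intro LIMSEQ_Suc LIMSEQ_power_zero) simp
    qed
    then show ?thesis using \<Phi>L f by (simp add: L2_converges_def)
  qed
  ultimately show ?thesis using that \<Phi>(1) by blast
qed

lemma complex_integral_square:
  "(LINT x|lborel. f x * cnj (f x)) = complex_of_real ((L2_norm f)\<^sup>2)"
  by (simp only: complex_norm_square[symmetric] L2_norm_square integral_complex_of_real)

text \<open>
  Approximate \<open>cnj h\<close> by test functions.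
\<close>

lemma L2_eq_0_if_orthogonal:
  assumes h: "h \<in> L2" and orth: "\<And>\<phi>. \<phi> \<in> test_functions \<Longrightarrow> (LINT x|lborel. h x * \<phi> x) = 0"
  shows "AE x in lborel. h x = 0"
proof -
  obtain \<Phi> where \<Phi>: "\<And>k. \<Phi> k \<in> test_functions" "L2_converges \<Phi> (\<lambda>x. cnj (h x))"
    by (rule test_functions_approximation[OF L2_cnj[OF h]]) blast
  have "(\<lambda>k. LINT x|lborel. h x * \<Phi> k x) \<longlonglongrightarrow> (LINT x|lborel. h x * cnj (h x))"
    by (rule L2_converges_pairing[OF L2_converges_const[OF h] \<Phi>(2)])
  then have "(LINT x|lborel. h x * cnj (h x)) = 0"
    by (simp add: orth[OF \<Phi>(1)] LIMSEQ_const_iff)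
  then have "L2_norm h = 0"
    by (simp add: complex_integral_square)
  then show ?thesis using L2_norm_eq_0_iff[OF h] by simp
qed

text \<open>
  This determines \<open>g\<close> from \<open>f\<close> alone, whatever sequence was chosen in the extension by continuity: it is what makes
  the choice in \<open>fourier\<close> unique almost everywhere.
\<close>

lemma fourier_limit_pairing:
  assumes int: "\<And>k. integrable lborel (F k)" and F: "L2_converges F f"
    and G: "L2_converges (\<lambda>k. fourier_L1 (F k)) g" and \<phi>: "\<phi> \<in> test_functions"
  shows "(LINT x|lborel. g x * \<phi> x) = (LINT x|lborel. f x * fourier_L1 \<phi> x)"
proof (rule LIMSEQ_unique)
  have \<phi>L: "\<phi> \<in> L2" and \<phi>i: "integrable lborel \<phi>"
    using \<phi> test_functions_L2 by (auto simp: test_functions_def)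
  show "(\<lambda>k. LINT x|lborel. fourier_L1 (F k) x * \<phi> x) \<longlonglongrightarrow> (LINT x|lborel. g x * \<phi> x)"
    by (rule L2_converges_pairing[OF G L2_converges_const[OF \<phi>L]])
  show "(\<lambda>k. LINT x|lborel. fourier_L1 (F k) x * \<phi> x) \<longlonglongrightarrow> (LINT x|lborel. f x * fourier_L1 \<phi> x)"
    unfolding fourier_L1_multiplication[OF int \<phi>i]
    by (rule L2_converges_pairing[OF F L2_converges_const[OF fourier_L1_isometry(1)[OF \<phi>]]])
qed

text \<open>
  Isometry makes the transforms of a fast approximating sequence a fast Cauchy sequence.
\<close>

lemma fourier_exists:
  assumes f: "f \<in> L2"
  shows "\<exists>g F. (\<forall>k. F k \<in> test_functions) \<and> L2_converges F f \<and> L2_converges (\<lambda>k. fourier_L1 (F k)) g"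
proof -
  obtain \<Phi> where \<Phi>: "\<And>k. \<Phi> k \<in> test_functions" "L2_converges \<Phi> f"
    "\<And>k. L2_norm (\<lambda>x. \<Phi> (Suc k) x - \<Phi> k x) \<le> (1 / 2) ^ k"
    by (rule test_functions_approximation[OF f]) blast
  have "\<exists>g. L2_converges (\<lambda>k. fourier_L1 (\<Phi> k)) g"
  proof (rule L2_complete)
    fix k
    show "fourier_L1 (\<Phi> k) \<in> L2" by (rule fourier_L1_isometry(1)[OF \<Phi>(1)])
    have "(\<lambda>x. fourier_L1 (\<Phi> (Suc k)) x - fourier_L1 (\<Phi> k) x) =
        fourier_L1 (\<lambda>x. 1 * \<Phi> (Suc k) x + (-1) * \<Phi> k x)"
      using \<Phi>(1)[of k] \<Phi>(1)[of "Suc k"]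
      by (intro ext, subst fourier_L1_lincomb) (auto simp: test_functions_def)
    then have "L2_norm (\<lambda>x. fourier_L1 (\<Phi> (Suc k)) x - fourier_L1 (\<Phi> k) x) =
        L2_norm (\<lambda>x. 1 * \<Phi> (Suc k) x + (-1) * \<Phi> k x)"
      by (simp only: fourier_L1_isometry(2)[OF test_functions_lincomb[OF \<Phi>(1) \<Phi>(1)]])
    with \<Phi>(3)[of k] show "L2_norm (\<lambda>x. fourier_L1 (\<Phi> (Suc k)) x - fourier_L1 (\<Phi> k) x) \<le> (1 / 2) ^ k"
      by simp
  qed
  with \<Phi> show ?thesis by blast
qed

lemma fourier_approximation:
  assumes f: "f \<in> L2"
  obtains F where "\<And>k. integrable lborel (F k)" "L2_converges F f" "L2_converges (\<lambda>k. fourier_L1 (F k)) (fourier f)"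
proof -
  have "\<exists>g F. (\<forall>k. integrable lborel (F k)) \<and> L2_converges F f \<and> L2_converges (\<lambda>k. fourier_L1 (F k)) g"
  proof -
    obtain g F where "\<And>k. F k \<in> test_functions" "L2_converges F f" "L2_converges (\<lambda>k. fourier_L1 (F k)) g"
      using fourier_exists[OF f] by blast
    moreover from this(1) have "integrable lborel (F k)" for k
      by (simp add: test_functions_def)
    ultimately show ?thesis by blast
  qed
  from someI_ex[OF this] that show ?thesis
    unfolding fourier_def[symmetric] by blast
qed

lemma fourier_L2 [simp]: "f \<in> L2 \<Longrightarrow> fourier f \<in> L2"
  by (rule fourier_approximation) (auto dest: L2_convergesD)

lemma fourier_pairing_test:
  assumes "f \<in> L2" "\<phi> \<in> test_functions"
  shows "(LINT x|lborel. fourier f x * \<phi> x) = (LINT x|lborel. f x * fourier_L1 \<phi> x)"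
  using fourier_limit_pairing[OF _ _ _ assms(2)] fourier_approximation[OF assms(1)] by metis

text \<open>
  Weak characterization of the transform, from which linearity and the comparison of different approximating
  sequences follow.
\<close>

lemma fourier_eqI:
  assumes f: "f \<in> L2" and g: "g \<in> L2"
    and eq: "\<And>\<phi>. \<phi> \<in> test_functions \<Longrightarrow> (LINT x|lborel. g x * \<phi> x) = (LINT x|lborel. f x * fourier_L1 \<phi> x)"
  shows "AE x in lborel. fourier f x = g x"
proof -
  have "AE x in lborel. fourier f x - g x = 0"
  proof (rule L2_eq_0_if_orthogonal)
    show "(\<lambda>x. fourier f x - g x) \<in> L2"
      using f g by (intro L2_diff) auto
    fix \<phi> :: "real^'a \<Rightarrow> complex" assume \<phi>: "\<phi> \<in> test_functions"
    then have \<phi>L: "\<phi> \<in> L2" using test_functions_L2 by blast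
    show "(LINT x|lborel. (fourier f x - g x) * \<phi> x) = 0"
      using L2_integrable_mult[OF fourier_L2[OF f] \<phi>L] L2_integrable_mult[OF g \<phi>L]
      by (simp add: left_diff_distrib fourier_pairing_test[OF f \<phi>] eq[OF \<phi>])
  qed
  then show ?thesis by simp
qed

lemma L2_converges_cong_AE:
  assumes F: "L2_converges F f" and g: "g \<in> L2" and eq: "AE x in lborel. f x = g x"
  shows "L2_converges F g"
proof -
  note F' = L2_convergesD[OF F]
  have "L2_norm (\<lambda>x. F k x - g x) = L2_norm (\<lambda>x. F k x - f x)" for k
    using eq by (intro L2_norm_cong_AE L2_measurable L2_diff F' g) auto
  then show ?thesis using F' g by (simp add: L2_converges_def)
qed

text \<open>
  The sequence provided by the choice in \<open>fourier\<close> consists of arbitrary integrable functions; here it is replaced by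
  one of test functions, on which the transform is known to be isometric.
\<close>

lemma fourier_approximation_test:
  assumes f: "f \<in> L2"
  obtains F where "\<And>k. F k \<in> test_functions" "L2_converges F f" "L2_converges (\<lambda>k. fourier_L1 (F k)) (fourier f)"
proof -
  obtain g F where F: "\<And>k. F k \<in> test_functions" "L2_converges F f" "L2_converges (\<lambda>k. fourier_L1 (F k)) g"
    using fourier_exists[OF f] by blast
  have "integrable lborel (F k)" for k
    using F(1) by (simp add: test_functions_def)
  then have "AE x in lborel. fourier f x = g x"
    using F by (intro fourier_eqI f fourier_limit_pairing) (auto dest: L2_convergesD)
  then have "AE x in lborel. g x = fourier f x"
    by eventually_elim simp
  with F that f show ?thesis
    using L2_converges_cong_AE[OF F(3)] by (meson fourier_L2)
qed

lemma fourier_norm: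
  assumes f: "f \<in> L2"
  shows "L2_norm (fourier f) = L2_norm f"
proof -
  obtain F where F: "\<And>k. F k \<in> test_functions" "L2_converges F f" "L2_converges (\<lambda>k. fourier_L1 (F k)) (fourier f)"
    by (rule fourier_approximation_test[OF f]) blast
  show ?thesis
    using L2_converges_norm[OF F(2)] L2_converges_norm[OF F(3)]
    by (simp add: fourier_L1_isometry(2)[OF F(1)] LIMSEQ_unique)
qed

lemma fourier_lincomb:
  assumes f: "f \<in> L2" and g: "g \<in> L2"
  shows "AE x in lborel. fourier (\<lambda>y. a * f y + b * g y) x = a * fourier f x + b * fourier g x"
proof (rule fourier_eqI)
  show "(\<lambda>y. a * f y + b * g y) \<in> L2" "(\<lambda>x. a * fourier f x + b * fourier g x) \<in> L2"
    using f g by (auto intro!: L2_add L2_scale)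
  fix \<phi> :: "real^'a \<Rightarrow> complex" assume \<phi>: "\<phi> \<in> test_functions"
  then have \<phi>L: "\<phi> \<in> L2" using test_functions_L2 by blast
  note \<phi>F = fourier_L1_isometry(1)[OF \<phi>]
  have "(LINT x|lborel. (a * fourier f x + b * fourier g x) * \<phi> x) =
     a * (LINT x|lborel. fourier f x * \<phi> x) + b * (LINT x|lborel. fourier g x * \<phi> x)"
    using L2_integrable_mult[OF fourier_L2[OF f] \<phi>L] L2_integrable_mult[OF fourier_L2[OF g] \<phi>L]
    by (simp add: distrib_right mult.assoc)
  also have "\<dots> = (LINT x|lborel. (a * f x + b * g x) * fourier_L1 \<phi> x)"
    using L2_integrable_mult[OF f \<phi>F] L2_integrable_mult[OF g \<phi>F]
    by (simp add: distrib_right mult.assoc fourier_pairing_test[OF f \<phi>] fourier_pairing_test[OF g \<phi>])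
  finally show "(LINT x|lborel. (a * fourier f x + b * fourier g x) * \<phi> x) =
      (LINT x|lborel. (a * f x + b * g x) * fourier_L1 \<phi> x)" .
qed

lemma fourier_multiplication:
  assumes f: "f \<in> L2" and g: "g \<in> L2"
  shows "(LINT x|lborel. fourier f x * g x) = (LINT x|lborel. f x * fourier g x)"
proof -
  obtain G where G: "\<And>k. G k \<in> test_functions" "L2_converges G g" "L2_converges (\<lambda>k. fourier_L1 (G k)) (fourier g)"
    by (rule fourier_approximation_test[OF g]) blast
  show ?thesis
    using L2_converges_pairing[OF L2_converges_const[OF fourier_L2[OF f]] G(2)]
      L2_converges_pairing[OF L2_converges_const[OF f] G(3)]
    unfolding fourier_pairing_test[OF f G(1)] by (rule LIMSEQ_unique)
qed

lemma fourier_inj: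
  assumes f: "f \<in> L2" and g: "g \<in> L2" and eq: "AE x in lborel. fourier f x = fourier g x"
  shows "AE x in lborel. f x = g x"
proof -
  let ?d = "\<lambda>y. 1 * f y + (-1) * g y"
  have d: "?d \<in> L2" using f g by (intro L2_add L2_scale)
  have "AE x in lborel. fourier ?d x = 0"
    using fourier_lincomb[OF f g, of 1 "-1"] eq by eventually_elim simp
  then have "L2_norm ?d = 0"
    using L2_norm_eq_0_iff[OF fourier_L2[OF d]] fourier_norm[OF d] by simp
  then show ?thesis
    using L2_norm_eq_0_iff[OF d] by simp
qed

text \<open>
  By the multiplication formula the adjoint of the Fourier transform \<open>\<F>\<close> is \<open>g \<mapsto> cnj (\<F> (cnj g))\<close>, which is isometric
  as well. With \<open>f\<close> the image of \<open>g\<close> under the adjoint, expanding the square gives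
  \<open>\<parallel>\<F> f - g\<parallel>\<^sup>2 = \<parallel>f\<parallel>\<^sup>2 - 2 \<parallel>f\<parallel>\<^sup>2 + \<parallel>g\<parallel>\<^sup>2 = 0\<close>. So surjectivity needs no inversion theorem.
\<close>

lemma fourier_surj:
  assumes g: "g \<in> L2"
  shows "\<exists>f\<in>L2. AE x in lborel. fourier f x = g x"
proof -
  define h where "h = fourier (\<lambda>x. cnj (g x))"
  define f where "f = (\<lambda>x. cnj (h x))"
  have gc: "(\<lambda>x. cnj (g x)) \<in> L2" using g by (rule L2_cnj)
  have h: "h \<in> L2" unfolding h_def by (rule fourier_L2[OF gc])
  have f: "f \<in> L2" unfolding f_def by (rule L2_cnj[OF h])
  have nf: "L2_norm f = L2_norm g"
    by (simp add: f_def h_def fourier_norm[OF gc])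
  let ?F = "fourier f"
  have F: "?F \<in> L2" by (rule fourier_L2[OF f])
  have d: "(\<lambda>x. ?F x - g x) \<in> L2" by (rule L2_diff[OF F g])
  have "(LINT x|lborel. ?F x * cnj (g x)) = (LINT x|lborel. f x * h x)"
    unfolding h_def by (rule fourier_multiplication[OF f gc])
  also have "\<dots> = (LINT x|lborel. f x * cnj (f x))"
    by (simp add: f_def)
  also have "\<dots> = complex_of_real ((L2_norm g)\<^sup>2)"
    by (simp only: complex_integral_square nf)
  finally have I: "(LINT x|lborel. ?F x * cnj (g x)) = complex_of_real ((L2_norm g)\<^sup>2)" .
  have I': "(LINT x|lborel. g x * cnj (?F x)) = complex_of_real ((L2_norm g)\<^sup>2)"
  proof -
    have "(LINT x|lborel. g x * cnj (?F x)) = (LINT x|lborel. cnj (?F x * cnj (g x)))"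
      by (simp add: mult.commute)
    also have "\<dots> = cnj (LINT x|lborel. ?F x * cnj (g x))"
      by (simp del: complex_cnj_mult)
    finally show ?thesis by (simp add: I)
  qed
  have "complex_of_real ((L2_norm (\<lambda>x. ?F x - g x))\<^sup>2) = (LINT x|lborel. (?F x - g x) * cnj (?F x - g x))"
    by (rule complex_integral_square[symmetric])
  also have "\<dots> = (LINT x|lborel. ((?F x * cnj (?F x) - ?F x * cnj (g x)) - g x * cnj (?F x)) + g x * cnj (g x))"
    by (simp add: algebra_simps)
  also have "\<dots> = (((LINT x|lborel. ?F x * cnj (?F x)) - (LINT x|lborel. ?F x * cnj (g x)))
      - (LINT x|lborel. g x * cnj (?F x))) + (LINT x|lborel. g x * cnj (g x))"
    using L2_integrable_mult[OF F L2_cnj[OF F]] L2_integrable_mult[OF F L2_cnj[OF g]]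
      L2_integrable_mult[OF g L2_cnj[OF F]] L2_integrable_mult[OF g L2_cnj[OF g]]
    by simp
  also have "\<dots> = 0"
    by (simp only: I I' complex_integral_square fourier_norm[OF f] nf) simp
  finally have "L2_norm (\<lambda>x. ?F x - g x) = 0"
    by simp
  then have "AE x in lborel. ?F x = g x"
    using L2_norm_eq_0_iff[OF d] by simp
  with f show ?thesis by blast
qed

section \<open>Fourier multipliers on a Paley-Wiener space\<close>

text \<open>
  A multiplier need only be bounded on \<open>K\<close>, because the transform of \<open>f\<close> vanishes elsewhere.
\<close>

lemma fourier_multiplier:
  assumes f: "f \<in> paley_wiener K" and m: "m \<in> borel_measurable borel"
    and bound: "\<And>x. x \<in> K \<Longrightarrow> cmod (m x) \<le> C"
  shows "\<exists>h. h \<in> L2 \<and> (AE x in lborel. fourier h x = m x * fourier f x)"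
proof -
  note [measurable] = m
  have fL: "f \<in> L2" and f0: "AE x in lborel. x \<notin> K \<longrightarrow> fourier f x = 0"
    using f by (auto simp: paley_wiener_def)
  note [measurable] = L2_measurable[OF fourier_L2[OF fL]]
  have "(\<lambda>x. m x * fourier f x) \<in> L2"
  proof (rule L2_bound(1)[OF fourier_L2[OF fL]])
    show "AE x in lborel. cmod (m x * fourier f x) \<le> C * cmod (fourier f x)"
      using f0
    proof eventually_elim
      case (elim x)
      then show ?case
        by (cases "x \<in> K") (auto simp: norm_mult intro: mult_right_mono bound)
    qed
  qed measurable
  from fourier_surj[OF this] show ?thesis by blast
qed

lemma fourier_multiplier_paley_wiener:
  assumes f: "f \<in> paley_wiener K" and h: "h \<in> L2"
    and eq: "AE x in lborel. fourier h x = m x * fourier f x"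
  shows "h \<in> paley_wiener K"
proof -
  have "AE x in lborel. x \<notin> K \<longrightarrow> fourier f x = 0"
    using f by (auto simp: paley_wiener_def)
  with eq have "AE x in lborel. x \<notin> K \<longrightarrow> fourier h x = 0"
    by eventually_elim auto
  with h show ?thesis by (simp add: paley_wiener_def)
qed

lemma fourier_multiplier_norm:
  assumes f: "f \<in> paley_wiener K" and h: "h \<in> L2"
    and eq: "AE x in lborel. fourier h x = m x * fourier f x"
    and bound: "\<And>x. x \<in> K \<Longrightarrow> cmod (m x) \<le> C" and C: "C \<ge> 0"
  shows "L2_norm h \<le> C * L2_norm f"
proof -
  have fL: "f \<in> L2" and f0: "AE x in lborel. x \<notin> K \<longrightarrow> fourier f x = 0"
    using f by (auto simp: paley_wiener_def)
  have "AE x in lborel. cmod (fourier h x) \<le> C * cmod (fourier f x)"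
    using f0 eq
  proof eventually_elim
    case (elim x)
    then show ?case
      by (cases "x \<in> K") (auto simp: norm_mult intro: mult_right_mono bound)
  qed
  from L2_bound(2)[OF fourier_L2[OF fL] L2_measurable[OF fourier_L2[OF h]] this C]
  show ?thesis by (simp add: fourier_norm fL h)
qed

lemma paley_wiener_lincomb:
  assumes f: "f \<in> paley_wiener K" and g: "g \<in> paley_wiener K"
  shows "(\<lambda>y. a * f y + b * g y) \<in> paley_wiener K"
proof -
  have L: "f \<in> L2" "g \<in> L2" and z: "AE x in lborel. x \<notin> K \<longrightarrow> fourier f x = 0"
    "AE x in lborel. x \<notin> K \<longrightarrow> fourier g x = 0"
    using f g by (auto simp: paley_wiener_def)
  have "AE x in lborel. x \<notin> K \<longrightarrow> fourier (\<lambda>y. a * f y + b * g y) x = 0"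
    using fourier_lincomb[OF L, of a b] z by eventually_elim auto
  with L show ?thesis by (auto simp: paley_wiener_def intro!: L2_add L2_scale)
qed

text \<open>
  On a bounded \<open>K\<close> the multiplier \<open>- \<bar>x\<bar>\<^sup>2\<close> is bounded, so the choice in \<open>laplacian\<close> has a witness.
\<close>

lemma laplacian_fourier:
  fixes K :: "(real^'n) set"
  assumes K: "bounded K" and f: "f \<in> paley_wiener K"
  shows "laplacian f \<in> paley_wiener K"
    and "AE x in lborel. fourier (laplacian f) x = - complex_of_real ((norm x)\<^sup>2) * fourier f x"
proof -
  obtain B where B: "\<And>x. x \<in> K \<Longrightarrow> norm x \<le> B"
    using K by (auto simp: bounded_iff)
  let ?m = "\<lambda>x::real^'n. - complex_of_real ((norm x)\<^sup>2)"
  have "\<exists>h. h \<in> L2 \<and> (AE x in lborel. fourier h x = ?m x * fourier f x)"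
  proof (rule fourier_multiplier[OF f])
    show "cmod (?m x) \<le> B\<^sup>2" if "x \<in> K" for x
      using power_mono[OF B[OF that] norm_ge_zero, of 2] by (simp add: norm_power)
  qed measurable
  from someI_ex[OF this]
  have *: "laplacian f \<in> L2" "AE x in lborel. fourier (laplacian f) x = ?m x * fourier f x"
    unfolding laplacian_def[symmetric] by auto
  show "laplacian f \<in> paley_wiener K"
    by (rule fourier_multiplier_paley_wiener[OF f *])
  from *(2) show "AE x in lborel. fourier (laplacian f) x = ?m x * fourier f x" .
qed

lemma fourier_diff_laplacian:
  fixes K :: "(real^'n) set"
  assumes K: "bounded K" and f: "f \<in> paley_wiener K"
  shows "(\<lambda>y. z * f y - laplacian f y) \<in> paley_wiener K"
    and "AE x in lborel. fourier (\<lambda>y. z * f y - laplacian f y) x =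
           (z + complex_of_real ((norm x)\<^sup>2)) * fourier f x"
proof -
  note l = laplacian_fourier[OF K f]
  have eq: "(\<lambda>y. z * f y - laplacian f y) = (\<lambda>y. z * f y + (-1) * laplacian f y)"
    by simp
  show "(\<lambda>y. z * f y - laplacian f y) \<in> paley_wiener K"
    unfolding eq by (rule paley_wiener_lincomb[OF f l(1)])
  have "f \<in> L2" "laplacian f \<in> L2"
    using f l(1) by (auto simp: paley_wiener_def)
  from fourier_lincomb[OF this, of z "-1"] l(2)
  show "AE x in lborel. fourier (\<lambda>y. z * f y - laplacian f y) x =
           (z + complex_of_real ((norm x)\<^sup>2)) * fourier f x"
    unfolding eq by eventually_elim (simp add: algebra_simps)
qed

section \<open>The spectrum\<close>

text \<open>
  The set of values \<open>- \<bar>x\<bar>\<^sup>2\<close> on \<open>K\<close> is compact, so \<open>z\<close> has a positive distance \<open>d\<close> from it, and \<open>1 / (z + \<bar>x\<bar>\<^sup>2)\<close> is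
  bounded by \<open>1 / d\<close> on \<open>K\<close>. This multiplier is the resolvent.
\<close>

lemma resolvent_set_laplacian:
  fixes K :: "(real^'n) set"
  assumes K: "compact K" and z: "\<And>x. x \<in> K \<Longrightarrow> z \<noteq> - complex_of_real ((norm x)\<^sup>2)"
  shows "z \<in> resolvent_set (paley_wiener K) laplacian"
proof -
  let ?H = "paley_wiener K"
  have Kb: "bounded K" using K by (rule compact_imp_bounded)
  have "compact ((\<lambda>x. - complex_of_real ((norm x)\<^sup>2)) ` K)"
    by (intro compact_continuous_image continuous_intros K)
  then have "closed ((\<lambda>x. - complex_of_real ((norm x)\<^sup>2)) ` K)"
    by (rule compact_imp_closed)
  from separate_point_closed[OF this, of z] z obtain d where d: "d > 0"
    and "\<forall>s\<in>(\<lambda>x. - complex_of_real ((norm x)\<^sup>2)) ` K. d \<le> dist z s"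
    by auto
  then have d': "d \<le> cmod (z + complex_of_real ((norm x)\<^sup>2))" if "x \<in> K" for x
    using that by (auto simp: dist_norm)
  define m where "m x = 1 / (z + complex_of_real ((norm x)\<^sup>2))" for x :: "real^'n"
  have mm: "m \<in> borel_measurable borel"
    unfolding m_def by measurable
  have mC: "cmod (m x) \<le> 1 / d" if "x \<in> K" for x
    using d'[OF that] d by (auto simp: m_def norm_divide intro!: divide_left_mono mult_pos_pos)
  have m1: "(z + complex_of_real ((norm x)\<^sup>2)) * m x = 1" if "x \<in> K" for x
    using d'[OF that] d by (auto simp: m_def)
  define R where "R f = (SOME h. h \<in> L2 \<and> (AE x in lborel. fourier h x = m x * fourier f x))" for f
  have R: "R f \<in> L2" "AE x in lborel. fourier (R f) x = m x * fourier f x" if "f \<in> ?H" for f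
    using someI_ex[OF fourier_multiplier[OF that mm mC]] unfolding R_def by auto
  have RH: "R f \<in> ?H" if "f \<in> ?H" for f
    using fourier_multiplier_paley_wiener[OF that R[OF that]] .
  have HL: "f \<in> L2" if "f \<in> ?H" for f
    using that by (simp add: paley_wiener_def)
  have supp: "AE x in lborel. x \<notin> K \<longrightarrow> fourier f x = 0" if "f \<in> ?H" for f
    using that by (simp add: paley_wiener_def)
  have "bounded_operator_on ?H R"
    unfolding bounded_operator_on_def
  proof (intro conjI ballI allI exI)
    fix f assume f: "f \<in> ?H"
    show "R f \<in> ?H" by (rule RH[OF f])
    show "L2_norm (R f) \<le> 1 / d * L2_norm f"
      using d by (intro fourier_multiplier_norm[OF f R[OF f] mC]) auto
  next
    fix f g a b assume f: "f \<in> ?H" and g: "g \<in> ?H"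
    note fg = paley_wiener_lincomb[OF f g, of a b]
    show "AE x in lborel. R (\<lambda>y. a * f y + b * g y) x = a * R f x + b * R g x"
    proof (rule fourier_inj)
      show "R (\<lambda>y. a * f y + b * g y) \<in> L2" by (rule R[OF fg])
      show "(\<lambda>x. a * R f x + b * R g x) \<in> L2"
        using R[OF f] R[OF g] by (intro L2_add L2_scale) auto
      show "AE x in lborel. fourier (R (\<lambda>y. a * f y + b * g y)) x = fourier (\<lambda>x. a * R f x + b * R g x) x"
        using R(2)[OF fg] R(2)[OF f] R(2)[OF g] fourier_lincomb[OF HL[OF f] HL[OF g], of a b]
          fourier_lincomb[OF R(1)[OF f] R(1)[OF g], of a b]
        by eventually_elim (simp add: algebra_simps)
    qed
  qed
  moreover have "AE x in lborel. R (\<lambda>y. z * f y - laplacian f y) x = f x" if f: "f \<in> ?H" for f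
  proof (rule fourier_inj)
    note u = fourier_diff_laplacian[OF Kb f, of z]
    show "R (\<lambda>y. z * f y - laplacian f y) \<in> L2" by (rule R(1)[OF u(1)])
    show "f \<in> L2" by (rule HL[OF f])
    show "AE x in lborel. fourier (R (\<lambda>y. z * f y - laplacian f y)) x = fourier f x"
      using R(2)[OF u(1)] u(2) supp[OF f]
    proof eventually_elim
      case (elim x)
      then show ?case
        using m1[of x] by (cases "x \<in> K") (auto simp: mult.assoc[symmetric] mult.commute[of "m x"])
    qed
  qed
  moreover have "AE x in lborel. z * R f x - laplacian (R f) x = f x" if f: "f \<in> ?H" for f
  proof (rule fourier_inj)
    note u = fourier_diff_laplacian[OF Kb RH[OF f], of z]
    show "(\<lambda>x. z * R f x - laplacian (R f) x) \<in> L2" by (rule HL[OF u(1)])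
    show "f \<in> L2" by (rule HL[OF f])
    show "AE x in lborel. fourier (\<lambda>x. z * R f x - laplacian (R f) x) x = fourier f x"
      using R(2)[OF f] u(2) supp[OF f]
    proof eventually_elim
      case (elim x)
      then show ?case
        using m1[of x] by (cases "x \<in> K") (auto simp: mult.assoc[symmetric])
    qed
  qed
  ultimately show ?thesis
    unfolding resolvent_set_def by blast
qed

text \<open>
  The transform of \<open>f\<close> is the indicator of a small piece \<open>U\<close> of \<open>K\<^sub>0\<close> near \<open>x\<^sub>0\<close>, where the multiplier
  \<open>\<bar>x\<bar>\<^sup>2 - \<bar>x\<^sub>0\<bar>\<^sup>2\<close> is small. Openness of \<open>K\<^sub>0\<close> makes \<open>U\<close> a nonempty open set, hence not a null set.
\<close>

lemma approximate_eigenfunction: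
  fixes K\<^sub>0 :: "(real^'n) set"
  assumes K\<^sub>0: "open K\<^sub>0" "bounded K\<^sub>0" and x\<^sub>0: "x\<^sub>0 \<in> closure K\<^sub>0" and e: "e > 0"
  shows "\<exists>f\<in>paley_wiener (closure K\<^sub>0). L2_norm f > 0 \<and>
    L2_norm (\<lambda>y. - complex_of_real ((norm x\<^sub>0)\<^sup>2) * f y - laplacian f y) \<le> e * L2_norm f"
proof -
  let ?z = "- complex_of_real ((norm x\<^sub>0)\<^sup>2)"
  have "isCont (\<lambda>x::real^'n. (norm x)\<^sup>2) x\<^sub>0" by (intro continuous_intros)
  then obtain r where r: "r > 0" and rle: "\<And>x. dist x x\<^sub>0 < r \<Longrightarrow> \<bar>(norm x)\<^sup>2 - (norm x\<^sub>0)\<^sup>2\<bar> < e"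
    using e unfolding continuous_at_eps_delta by (auto simp: dist_real_def)
  define U where "U = K\<^sub>0 \<inter> ball x\<^sub>0 r"
  have Uo: "open U" unfolding U_def using K\<^sub>0 by auto
  have Une: "U \<noteq> {}"
    using x\<^sub>0 r unfolding U_def closure_approachable by (force simp: dist_commute)
  have UK: "U \<subseteq> closure K\<^sub>0" using closure_subset unfolding U_def by blast
  have [measurable]: "U \<in> sets borel" using Uo by simp
  have Ufin: "emeasure lborel U < \<infinity>"
    by (rule emeasure_bounded_finite) (auto simp: U_def K\<^sub>0 intro: bounded_subset[OF K\<^sub>0(2)])
  have "\<not> negligible U" using Uo Une open_not_negligible by blast
  then have Upos: "emeasure lborel U > 0"
    by (simp add: negligible_iff_null_sets null_sets_def zero_less_iff_neq_zero emeasure_completion)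
  define g :: "real^'n \<Rightarrow> complex" where "g = indicator U"
  have gsq: "(cmod (g x))\<^sup>2 = indicator U x" for x
    by (simp add: g_def indicator_def)
  have gL: "g \<in> L2"
    using Ufin unfolding L2_def mem_Collect_eq gsq by (auto simp: g_def)
  have gpos: "L2_norm g > 0"
    using Upos Ufin unfolding L2_norm_def gsq by (simp add: measure_def enn2real_positive_iff)
  obtain f where fL: "f \<in> L2" and fg: "AE x in lborel. fourier f x = g x"
    using fourier_surj[OF gL] by blast
  \<comment> \<open>as an element of the smaller space for \<open>U\<close>, \<open>f\<close> only sees the multiplier on \<open>U\<close>\<close>
  have fU: "f \<in> paley_wiener U"
    using fL fg by (auto simp: paley_wiener_def g_def elim!: eventually_mono)
  have f: "f \<in> paley_wiener (closure K\<^sub>0)"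
    using fU UK by (auto simp: paley_wiener_def elim!: eventually_mono)
  have Kb: "bounded (closure K\<^sub>0)" using K\<^sub>0(2) by (rule bounded_closure)
  note u = fourier_diff_laplacian[OF Kb f, of ?z]
  have nf: "L2_norm f = L2_norm g"
    using L2_norm_cong_AE[OF L2_measurable[OF fourier_L2[OF fL]] L2_measurable[OF gL] fg]
    by (simp add: fourier_norm[OF fL])
  have "L2_norm (\<lambda>y. ?z * f y - laplacian f y) \<le> e * L2_norm f"
  proof (rule fourier_multiplier_norm[OF fU _ u(2)])
    show "(\<lambda>y. ?z * f y - laplacian f y) \<in> L2" using u(1) by (simp add: paley_wiener_def)
    fix x assume "x \<in> U"
    then have "\<bar>(norm x)\<^sup>2 - (norm x\<^sub>0)\<^sup>2\<bar> < e"
      by (intro rle) (simp add: U_def dist_commute)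
    moreover have "cmod (?z + complex_of_real ((norm x)\<^sup>2)) = \<bar>(norm x)\<^sup>2 - (norm x\<^sub>0)\<^sup>2\<bar>"
      by (metis add.commute norm_of_real of_real_diff uminus_add_conv_diff)
    ultimately show "cmod (?z + complex_of_real ((norm x)\<^sup>2)) \<le> e" by simp
  qed (use e in simp)
  with f gpos show ?thesis by (intro bexI[of _ f] conjI) (simp_all only: nf)
qed

text \<open>
  A bounded left inverse bounds \<open>z - T\<close> from below, which approximate eigenfunctions contradict.
\<close>

lemma not_in_resolvent_set:
  assumes ap: "\<And>e. e > 0 \<Longrightarrow> \<exists>f\<in>H. L2_norm f > 0 \<and> L2_norm (\<lambda>y. z * f y - T f y) \<le> e * L2_norm f"
    and cl: "\<And>f. f \<in> H \<Longrightarrow> (\<lambda>y. z * f y - T f y) \<in> H" and HL: "H \<subseteq> L2"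
  shows "z \<notin> resolvent_set H T"
proof
  assume "z \<in> resolvent_set H T"
  then obtain R where R: "bounded_operator_on H R"
    and inv: "\<And>f. f \<in> H \<Longrightarrow> AE x in lborel. R (\<lambda>y. z * f y - T f y) x = f x"
    unfolding resolvent_set_def by blast
  then obtain C where C: "\<And>f. f \<in> H \<Longrightarrow> L2_norm (R f) \<le> C * L2_norm f"
    and RH: "\<And>f. f \<in> H \<Longrightarrow> R f \<in> H"
    unfolding bounded_operator_on_def by blast
  define c where "c = \<bar>C\<bar> + 1"
  have c: "c > 0" "C \<le> c" by (auto simp: c_def)
  \<comment> \<open>small enough that \<open>C * e\<close> is at most one half\<close>
  define e where "e = 1 / (2 * c)"
  have e: "e > 0" using c by (simp add: e_def)
  obtain f where f: "f \<in> H" and pos: "L2_norm f > 0"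
    and le: "L2_norm (\<lambda>y. z * f y - T f y) \<le> e * L2_norm f"
    using ap[OF e] by blast
  let ?u = "\<lambda>y. z * f y - T f y"
  have "L2_norm f = L2_norm (R ?u)"
    using inv[OF f] RH[OF cl[OF f]] f HL
    by (intro L2_norm_cong_AE) (auto intro: L2_measurable)
  also have "\<dots> \<le> C * L2_norm ?u" by (rule C[OF cl[OF f]])
  also have "\<dots> \<le> c * (e * L2_norm f)"
    using le c by (intro mult_mono) auto
  also have "\<dots> = L2_norm f / 2"
    using c by (simp add: e_def)
  finally show False using pos by simp
qed

theorem theorem1:
  fixes K\<^sub>0 K :: "(real^'n) set"
  assumes "open K\<^sub>0" and "bounded K\<^sub>0" and "K = closure K\<^sub>0"
  shows "spectrum (paley_wiener K) laplacian = {- complex_of_real ((norm x)\<^sup>2) | x. x \<in> K}"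
proof -
  have K: "compact K" using assms by (simp add: compact_closure)
  have "z \<in> resolvent_set (paley_wiener K) laplacian \<longleftrightarrow> (\<forall>x\<in>K. z \<noteq> - complex_of_real ((norm x)\<^sup>2))" for z
  proof
    assume z: "z \<in> resolvent_set (paley_wiener K) laplacian"
    show "\<forall>x\<in>K. z \<noteq> - complex_of_real ((norm x)\<^sup>2)"
    proof (intro ballI notI)
      fix x assume x: "x \<in> K" and zx: "z = - complex_of_real ((norm x)\<^sup>2)"
      have "z \<notin> resolvent_set (paley_wiener K) laplacian"
      proof (rule not_in_resolvent_set)
        show "\<exists>f\<in>paley_wiener K. L2_norm f > 0 \<and> L2_norm (\<lambda>y. z * f y - laplacian f y) \<le> e * L2_norm f"
          if "e > 0" for e
          using approximate_eigenfunction[OF assms(1,2) _ that, of x] x unfolding zx assms(3) by blast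
        show "(\<lambda>y. z * f y - laplacian f y) \<in> paley_wiener K" if "f \<in> paley_wiener K" for f
          by (rule fourier_diff_laplacian(1)[OF compact_imp_bounded[OF K] that])
      qed (auto simp: paley_wiener_def)
      with z show False by blast
    qed
  qed (use resolvent_set_laplacian[OF K] in blast)
  then show ?thesis
    unfolding spectrum_def by blast
qed

end
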